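(* Suppose that $X\in\mathcal{M}_\infty$ and $0<q\le1$ (with $X$ transient if $q=1$). Let $C_q=G_q(\mathfrak{o},\mathfrak{o})$. Then for any $b\in E$ and $x\in E^{b]}$, $$\mathbb{E}_x(q^{T_{b]}})=1+(q-1)C_q\sum_{y\in E^{b]}}\widehat H_q(y)\left(\mathbf{H}_q^{b]}(x)-\mathbf{H}_q^{y]}(x)\right)\pi(y),$$ and, for any $a>b$ and $x\in E^{(b,a)^c}$, $$\mathbb{E}_x(q^{T_{(b,a)^c}})=1+(q-1)C_q\sum_{y\in E^{(b,a)^c}}\widehat H_q(y)\left(\frac{\mathbf{H}_q^{y]}(a)}{\mathbf{H}_q^{b]}(a)}\mathbf{H}_q^{b]}(x)-\mathbf{H}_q^{y]}(x)\right)\pi(y).$$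
   Context: $E\subseteq\mathbb{Z}$ is a countable interval of integers with left endpoint $\mathfrak{l}$ and right endpoint $\mathfrak{r}$ (possibly infinite), each of which may or may not belong to $E$. $X=(X_n)_{n\ge0}$ is a Markov chain on $E$ with transition matrix $P=(p(x,y))_{x,y\in E}$. $\mathcal{M}$ is the set of such chains that are irreducible (for all $x,y$ with $\mathfrak{l}<x,y<\mathfrak{r}$, $p^{(n)}(x,y)=\mathbb{P}_x(X_n=y)>0$ for some $n$) and upward skip-free: $p(x,x+1)>0$ and $p(x,x+y)=0$ for $y\ge2$. Convention: $\mathfrak{r}\in E$ if $\mathfrak{r}$ is not absorbing; if $\mathfrak{r}$ is absorbing or $\mathfrak{r}=\infty$ (so $\mathfrak{r}\notin E$), one writes $X\in\mathcal{M}_\infty$. $\pi$ is a fixed positive finite-valued excessive measure ($\pi P\le\pi$). $G_q(x,y)=\sum_{n\ge0}q^n\frac{p^{(n)}(x,y)}{\pi(y)}$. The dual matrix $\widehat P$ is $\widehat p(y,x)\pi(y)=p(x,y)\pi(x)$, with $q$-potential kernel $\widehat G_q$ defined in the same way. A reference point $\mathfrak{o}\in E$, $\mathfrak{o}<\mathfrak{r}-1$, is fixed; $K_q(x,y)=G_q(x,y)/G_q(\mathfrak{o},y)$, $\widehat K_q(x,y)=\widehat G_q(x,y)/\widehat G_q(\mathfrak{o},y)$; $H_q(x)=\lim_{y\to\mathfrak{r}}K_q(x,y)$ and $\widehat H_q(x)=\lim_{y\to\mathfrak{l}}\widehat K_q(x,y)$. For $y\in E$: $E^{y]}=\{x\in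 E:x>y\}$; $P^{y]}$ is the restriction of $P$ to $E^{y]}$ (the chain killed upon entering $\{x\in E: x\le y\}$); $G_q^{y]}$ is its $q$-potential kernel with respect to $\pi$; $K_q^{y]}(x,z)=G_q^{y]}(x,z)/G_q^{y]}(\mathfrak{o}^{y]},z)$ for a chosen reference point $\mathfrak{o}^{y]}\in E^{y]}$; and $$\mathbf{H}_q^{y]}(x)=\kappa_q^{y]}\lim_{z\to\mathfrak{r}}K_q^{y]}(x,z)\ (x>y),\qquad \mathbf{H}_q^{y]}(x)=0\ (x\le y),$$ where $\kappa_q^{y]}\in(0,\infty)$ is the normalizing constant such that $\lim_{x\to\mathfrak{r}}\mathbf{H}_q^{y]}(x)/H_q(x)=1$. For $A\subset E$, $T_A=\inf\{n\ge0:X_n\in A\}$ ($\inf\emptyset=\infty$). $T_{b]}$ is the hitting time of $\{z\in E:z\le b\}$; $T_{(b,a)^c}$ is the hitting time of $\{z\in E: z\le b\text{ or }z\ge a\}$; $E^{(b,a)^c}=\{z\in E:b<z<a\}$ is the state space of the chain killed upon entering $(b,a)^c$.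
   Formalization: If r is finite and absorbing, T_{b]} in the first identity also counts hitting r (with T_{b]} as printed it fails for q<1), and limits to r are values at r, with the kernels extended to r; for r = infinity nothing is changed. *)

theory Defs
  imports "HOL-Probability.Probability" "HOL-Library.Extended" "HOL-Library.Extended_Nat"
begin

text \<open>The endpoints are extended integers (\<^typ>\<open>int extended\<close>); a finite endpoint may or may not
  belong to \<open>E\<close>.\<close>

definition int_interval :: "int set \<Rightarrow> int extended \<Rightarrow> int extended \<Rightarrow> bool" where
  "int_interval E \<ll> \<rr> \<longleftrightarrow>
     {x. \<ll> < Fin x \<and> Fin x < \<rr>} \<subseteq> E \<and> E \<subseteq> {x. \<ll> \<le> Fin x \<and> Fin x \<le> \<rr>}"

text \<open>The right endpoint as an absorbing state outside \<open>E\<close>: a singleton if \<open>\<rr>\<close> is finite and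
  \<open>\<rr> \<notin> E\<close>, and empty if \<open>\<rr> = \<infinity>\<close>.  The process itself lives on \<open>states E \<rr>\<close>.  Absorption at
  the endpoint ends the chain on \<open>E\<close>, hence also the chain killed on entering \<open>{z \<in> E. z \<le> b}\<close>;
  the lifetime of the latter is the hitting time of \<open>{z \<in> E. z \<le> b} \<union> absorbing_end E \<rr>\<close>.\<close>

definition absorbing_end :: "int set \<Rightarrow> int extended \<Rightarrow> int set" where
  "absorbing_end E \<rr> = {z. Fin z = \<rr>} - E"

definition states :: "int set \<Rightarrow> int extended \<Rightarrow> int set" where
  "states E \<rr> = E \<union> absorbing_end E \<rr>"

definition above :: "int set \<Rightarrow> int \<Rightarrow> int set" where
  "above E y = {x\<in>E. y < x}"

definition between :: "int set \<Rightarrow> int \<Rightarrow> int \<Rightarrow> int set" where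
  "between E b a = {x\<in>E. b < x \<and> x < a}"

definition stochastic_matrix :: "int set \<Rightarrow> (int \<Rightarrow> int \<Rightarrow> real) \<Rightarrow> bool" where
  "stochastic_matrix S p \<longleftrightarrow>
     (\<forall>x\<in>S. (\<forall>y\<in>S. 0 \<le> p x y) \<and> (p x has_sum 1) S)"

text \<open>Powers of the restriction of \<open>p\<close> to \<open>A\<close>.  All intermediate points lie in \<open>A\<close>, so for
  \<open>x \<in> A\<close> and \<open>y \<notin> A\<close> the value is the weight of the paths that enter \<open>y\<close> for the first time
  at time \<open>n\<close>, having stayed in \<open>A\<close> before.\<close>

fun mpow :: "int set \<Rightarrow> (int \<Rightarrow> int \<Rightarrow> real) \<Rightarrow> nat \<Rightarrow> int \<Rightarrow> int \<Rightarrow> real" where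
  "mpow A p 0 x y = of_bool (x = y)"
| "mpow A p (Suc n) x y = (\<Sum>\<^sub>\<infinity>z\<in>A. mpow A p n x z * p z y)"

definition irreducible_chain ::
  "int set \<Rightarrow> int extended \<Rightarrow> int extended \<Rightarrow> (int \<Rightarrow> int \<Rightarrow> real) \<Rightarrow> bool" where
  "irreducible_chain E \<ll> \<rr> p \<longleftrightarrow>
     (\<forall>x y. \<ll> < Fin x \<and> Fin x < \<rr> \<and> \<ll> < Fin y \<and> Fin y < \<rr> \<longrightarrow> (\<exists>n. 0 < mpow E p n x y))"

definition upward_skip_free ::
  "int set \<Rightarrow> int extended \<Rightarrow> (int \<Rightarrow> int \<Rightarrow> real) \<Rightarrow> bool" where
  "upward_skip_free E \<rr> p \<longleftrightarrow>
     (\<forall>x\<in>E. (Fin x < \<rr> \<longrightarrow> 0 < p x (x + 1)) \<and>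
            (\<forall>y\<ge>2. x + y \<in> states E \<rr> \<longrightarrow> p x (x + y) = 0))"

definition skip_free_class ::
  "int set \<Rightarrow> int extended \<Rightarrow> int extended \<Rightarrow> (int \<Rightarrow> int \<Rightarrow> real) \<Rightarrow> bool" where
  "skip_free_class E \<ll> \<rr> p \<longleftrightarrow>
     int_interval E \<ll> \<rr> \<and> stochastic_matrix (states E \<rr>) p \<and>
     irreducible_chain E \<ll> \<rr> p \<and> upward_skip_free E \<rr> p \<and>
     (\<forall>k. Fin k = \<rr> \<longrightarrow> (k \<in> E \<longleftrightarrow> p k k \<noteq> 1))"

definition skip_free_class_inf ::
  "int set \<Rightarrow> int extended \<Rightarrow> int extended \<Rightarrow> (int \<Rightarrow> int \<Rightarrow> real) \<Rightarrow> bool" where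
  "skip_free_class_inf E \<ll> \<rr> p \<longleftrightarrow>
     skip_free_class E \<ll> \<rr> p \<and> (\<rr> = Pinf \<or> (\<exists>k. Fin k = \<rr> \<and> p k k = 1))"

definition markov_chain ::
  "int set \<Rightarrow> (int \<Rightarrow> int \<Rightarrow> real) \<Rightarrow> (int \<Rightarrow> 'w measure) \<Rightarrow> (nat \<Rightarrow> 'w \<Rightarrow> int) \<Rightarrow> bool" where
  "markov_chain S p Pr X \<longleftrightarrow>
     (\<forall>x\<in>S. prob_space (Pr x) \<and>
        (\<forall>n. X n \<in> measurable (Pr x) (count_space S)) \<and>
        measure (Pr x) {\<omega>\<in>space (Pr x). X 0 \<omega> = x} = 1 \<and>
        (\<forall>n. \<forall>s\<in>UNIV \<rightarrow> S.
           measure (Pr x) {\<omega>\<in>space (Pr x). \<forall>i\<le>Suc n. X i \<omega> = s i} =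
           measure (Pr x) {\<omega>\<in>space (Pr x). \<forall>i\<le>n. X i \<omega> = s i} * p (s n) (s (Suc n))))"

definition transient_chain ::
  "int set \<Rightarrow> (int \<Rightarrow> 'w measure) \<Rightarrow> (nat \<Rightarrow> 'w \<Rightarrow> int) \<Rightarrow> bool" where
  "transient_chain E Pr X \<longleftrightarrow>
     (\<forall>x\<in>E. measure (Pr x) {\<omega>\<in>space (Pr x). \<exists>n\<ge>1. X n \<omega> = x} < 1)"

definition hitting_time :: "(nat \<Rightarrow> 'w \<Rightarrow> int) \<Rightarrow> int set \<Rightarrow> 'w \<Rightarrow> enat" where
  "hitting_time X A \<omega> = Inf {enat n | n. X n \<omega> \<in> A}"

text \<open>For an infinite exponent the power is the limit of the finite powers: \<open>0\<close> for
  \<open>0 \<le> q < 1\<close>, and \<open>1\<close> for \<open>q = 1\<close>.\<close>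

definition epow :: "real \<Rightarrow> enat \<Rightarrow> real" where
  "epow q t = (case t of enat n \<Rightarrow> q ^ n | \<infinity> \<Rightarrow> lim (\<lambda>n. q ^ n))"

definition excessive_measure ::
  "int set \<Rightarrow> (int \<Rightarrow> int \<Rightarrow> real) \<Rightarrow> (int \<Rightarrow> real) \<Rightarrow> bool" where
  "excessive_measure E p \<pi> \<longleftrightarrow>
     (\<forall>y\<in>E. 0 < \<pi> y \<and> (\<lambda>x. \<pi> x * p x y) summable_on E \<and>
            (\<Sum>\<^sub>\<infinity>x\<in>E. \<pi> x * p x y) \<le> \<pi> y)"

definition dual_matrix :: "(int \<Rightarrow> int \<Rightarrow> real) \<Rightarrow> (int \<Rightarrow> real) \<Rightarrow> int \<Rightarrow> int \<Rightarrow> real" where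
  "dual_matrix p \<pi> y x = p x y * \<pi> x / \<pi> y"

text \<open>The \<open>q\<close>-potential kernel on \<open>A \<subseteq> E\<close> with respect to \<open>\<pi>\<close>.  The measure \<open>\<pi>\<close> lives on \<open>E\<close>; for a
  second argument outside \<open>E\<close> (needed only at an absorbing right endpoint) unit mass is used,
  which cancels in the ratios below.\<close>

definition potential ::
  "int set \<Rightarrow> int set \<Rightarrow> (int \<Rightarrow> int \<Rightarrow> real) \<Rightarrow> (int \<Rightarrow> real) \<Rightarrow> real \<Rightarrow> int \<Rightarrow> int \<Rightarrow> real" where
  "potential E A p \<pi> q x y =
     (\<Sum>n. q ^ n * (mpow A p n x y / (if y \<in> E then \<pi> y else 1)))"

definition martin_kernel ::
  "int set \<Rightarrow> int set \<Rightarrow> (int \<Rightarrow> int \<Rightarrow> real) \<Rightarrow> (int \<Rightarrow> real) \<Rightarrow> int \<Rightarrow> real \<Rightarrow> int \<Rightarrow> int \<Rightarrow> real" where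
  "martin_kernel E A p \<pi> \<oo> q x y = potential E A p \<pi> q x y / potential E A p \<pi> q \<oo> y"

text \<open>Convergence to an end of a set of integers, along the set.  If the set has a greatest
  (least) element, the limit is the value there; in particular, limits towards an absorbing
  right endpoint are values at this endpoint, with all kernels taken on \<open>states E \<rr>\<close>.\<close>

definition to_right :: "int set \<Rightarrow> int filter" where
  "to_right A = (INF a\<in>A. principal {z\<in>A. a \<le> z})"

definition to_left :: "int set \<Rightarrow> int filter" where
  "to_left A = (INF a\<in>A. principal {z\<in>A. z \<le> a})"

definition H_fun ::
  "int set \<Rightarrow> int extended \<Rightarrow> (int \<Rightarrow> int \<Rightarrow> real) \<Rightarrow> (int \<Rightarrow> real) \<Rightarrow> int \<Rightarrow> real \<Rightarrow> int \<Rightarrow> real" where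
  "H_fun E \<rr> p \<pi> \<oo> q x =
     Lim (to_right (states E \<rr>)) (\<lambda>y. martin_kernel E E p \<pi> \<oo> q x y)"

definition H_hat ::
  "int set \<Rightarrow> (int \<Rightarrow> int \<Rightarrow> real) \<Rightarrow> (int \<Rightarrow> real) \<Rightarrow> int \<Rightarrow> real \<Rightarrow> int \<Rightarrow> real" where
  "H_hat E p \<pi> \<oo> q x =
     Lim (to_left E) (\<lambda>y. martin_kernel E E (dual_matrix p \<pi>) \<pi> \<oo> q x y)"

text \<open>In the following, \<open>ref y\<close> is the reference point chosen in \<open>above E y\<close>.\<close>

definition K_limit_above ::
  "int set \<Rightarrow> int extended \<Rightarrow> (int \<Rightarrow> int \<Rightarrow> real) \<Rightarrow> (int \<Rightarrow> real) \<Rightarrow> (int \<Rightarrow> int) \<Rightarrow>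
   real \<Rightarrow> int \<Rightarrow> int \<Rightarrow> real" where
  "K_limit_above E \<rr> p \<pi> ref q y x =
     Lim (to_right (states E \<rr>)) (\<lambda>z. martin_kernel E (above E y) p \<pi> (ref y) q x z)"

definition kappa ::
  "int set \<Rightarrow> int extended \<Rightarrow> (int \<Rightarrow> int \<Rightarrow> real) \<Rightarrow> (int \<Rightarrow> real) \<Rightarrow> int \<Rightarrow> (int \<Rightarrow> int) \<Rightarrow>
   real \<Rightarrow> int \<Rightarrow> real" where
  "kappa E \<rr> p \<pi> \<oo> ref q y =
     (THE k. 0 < k \<and>
        ((\<lambda>x. k * K_limit_above E \<rr> p \<pi> ref q y x / H_fun E \<rr> p \<pi> \<oo> q x) \<longlongrightarrow> 1)
          (to_right (states E \<rr>)))"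

definition H_above ::
  "int set \<Rightarrow> int extended \<Rightarrow> (int \<Rightarrow> int \<Rightarrow> real) \<Rightarrow> (int \<Rightarrow> real) \<Rightarrow> int \<Rightarrow> (int \<Rightarrow> int) \<Rightarrow>
   real \<Rightarrow> int \<Rightarrow> int \<Rightarrow> real" where
  "H_above E \<rr> p \<pi> \<oo> ref q y x =
     (if y < x then kappa E \<rr> p \<pi> \<oo> ref q y * K_limit_above E \<rr> p \<pi> ref q y x else 0)"

end

theory Submission
  imports Defs
begin

text \<open>
  For \<open>q = 1\<close> the factor \<open>q - 1\<close> vanishes and both sides are \<open>1\<close>.  Let \<open>q < 1\<close>, let \<open>T\<close> be the
  hitting time of a set \<open>C\<close>, and let \<open>g\<^sup>A(x,y) = \<Sum>n. q\<^sup>n (P\<^sub>A)\<^sup>n(x,y)\<close> for the restriction \<open>P\<^sub>A\<close> of the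
  transition matrix to \<open>A\<close>.  From \<open>q\<^sup>T = 1 - (1 - q) \<Sum>n. q\<^sup>n [T > n]\<close> one obtains
  \<open>E\<^sub>x q\<^sup>T = 1 - (1 - q) \<Sum>y\<in>A. g\<^sup>A(x,y)\<close> with \<open>A\<close> the complement of \<open>C\<close>
  (\<open>expectation_epow_hitting_time\<close>).  It remains to identify \<open>g\<^sup>A(x,y)\<close>, for each \<open>y\<close> separately,
  with the summand of the claimed formula.

  The main tool is the effect of killing at one point (\<open>green_kill_point\<close>): for \<open>y \<in> A\<close>, \<open>z \<noteq> y\<close>,
  \<open>g\<^bsup>A - {y}\<^esup>(x,z) = g\<^sup>A(x,z) - g\<^sup>A(x,y) g\<^sup>A(y,z) / g\<^sup>A(y,y)\<close>.  Both sides solve the same forward equation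
  in \<open>z\<close>, and \<open>d \<mapsto> q d P\<close> is a contraction of the summable functions.  A skip-free chain visits
  every point on its way up.  Hence, for paths that end above \<open>y\<close>, killing at \<open>y\<close> is killing on
  all of \<open>{w. w \<le> y}\<close> (\<open>green_kill_above\<close>), and for paths that start and end below \<open>a\<close>, killing at
  \<open>a\<close> is killing on all of \<open>{w. a \<le> w}\<close> (\<open>green_kill_below\<close>).  In particular
  \<open>g(x,z) g(y,y) = g(x,y) g(y,z)\<close> for \<open>x \<le> y \<le> z\<close> (\<open>green_through\<close>).

  By this product formula all Martin kernels are constant near the ends of \<open>E\<close>, and the limits
  have closed forms in terms of \<open>g = g\<^sup>E\<close>: \<open>H(x) = g(x,z) / g(\<oo>,z)\<close> for any \<open>z \<ge> x, \<oo>\<close>;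
  \<open>H\<^sub>y(x) = H(x) - g(x,y) H(y) / g(y,y)\<close> for the chain killed at or below \<open>y\<close> (\<open>H_above_eq\<close>); and
  \<open>C\<^sub>q \<cdot> H_hat(y) \<cdot> \<pi>(y) = g(y,y) / H(y)\<close> for the dual one (\<open>H_hat_eq\<close>).  The normalisation of \<open>H\<^sub>y\<close> is
  right because \<open>g(x,y) / H(x)\<close> tends to \<open>0\<close> at the right end (\<open>Hq_above_asymp\<close>).  With these values
  the first formula is the killing identity at \<open>b\<close>, and the second one follows from it by a further
  killing at \<open>a\<close>.
\<close>

section \<open>Powers of a killed matrix and their generating functions\<close>

lemma of_bool_has_sum:
  "x \<in> A \<Longrightarrow> ((\<lambda>z. of_bool (x = z) :: real) has_sum 1) A"
  by (rule has_sum_finite_neutralI[where B = "{x}"]) auto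

text \<open>Once outside \<open>B\<close>, a path cannot enter \<open>B\<close> or end in \<open>Z\<close>, so only paths that stay in \<open>B\<close> until
  their last step contribute.  The set \<open>Z\<close> may be larger than \<open>B'\<close>: an absorbing endpoint lies in
  \<open>Z\<close> although no power of the restricted matrix passes through it.\<close>

lemma mpow_no_entrance:
  assumes B: "B \<subseteq> B'" "B \<subseteq> Z" and no: "\<And>w z. w \<in> B' - B \<Longrightarrow> z \<in> Z \<Longrightarrow> p w z = 0"
    and z: "z \<in> Z"
  shows "mpow B' p n x z = mpow B p n x z"
  using z
proof (induction n arbitrary: z)
  case (Suc n)
  have "(\<Sum>\<^sub>\<infinity>w\<in>B'. mpow B' p n x w * p w z) = (\<Sum>\<^sub>\<infinity>w\<in>B. mpow B p n x w * p w z)"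
    by (rule infsum_cong_neutral) (use B no Suc in auto)
  then show ?case by simp
qed simp

text \<open>By induction no weight ever reaches \<open>B' - B\<close>, so enlarging the state space changes nothing on
  \<open>B\<close>.\<close>

lemma mpow_no_escape:
  assumes B: "B \<subseteq> B'" and x: "x \<in> B" and no: "\<And>w z. w \<in> B \<Longrightarrow> z \<in> B' - B \<Longrightarrow> p w z = 0"
    and z: "z \<in> B'"
  shows "mpow B' p n x z = (if z \<in> B then mpow B p n x z else 0)"
  using z
proof (induction n arbitrary: z)
  case (Suc n)
  have "(\<Sum>\<^sub>\<infinity>w\<in>B'. mpow B' p n x w * p w z) = (\<Sum>\<^sub>\<infinity>w\<in>B. mpow B p n x w * p w z)"
    by (rule infsum_cong_neutral) (use B Suc.IH in auto)
  moreover have "(\<Sum>\<^sub>\<infinity>w\<in>B. mpow B p n x w * p w z) = 0" if "z \<notin> B"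
    using no Suc.prems that by (intro infsum_0) auto
  ultimately show ?case by simp
qed (use x in auto)

locale killed_kernel =
  fixes S :: "int set" and p :: "int \<Rightarrow> int \<Rightarrow> real" and q :: real
  assumes stochastic: "stochastic_matrix S p"
    and q_pos: "0 < q" and q_less_1: "q < 1"
begin

lemma p_nonneg: "x \<in> S \<Longrightarrow> y \<in> S \<Longrightarrow> 0 \<le> p x y"
  using stochastic by (auto simp: stochastic_matrix_def)

lemma p_has_sum: "x \<in> S \<Longrightarrow> (p x has_sum 1) S"
  using stochastic by (auto simp: stochastic_matrix_def)

lemma p_le_1: "x \<in> S \<Longrightarrow> y \<in> S \<Longrightarrow> p x y \<le> 1"
  using finite_sum_le_has_sum[OF p_has_sum, of x "{y}"] p_nonneg[of x] by auto

lemma mpow_nonneg: "A \<subseteq> S \<Longrightarrow> z \<in> S \<Longrightarrow> 0 \<le> mpow A p n x z"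
  by (induction n arbitrary: z) (auto intro!: infsum_nonneg mult_nonneg_nonneg p_nonneg)

lemma weight_joint_summable:
  assumes f: "f summable_on A" "\<And>w. w \<in> A \<Longrightarrow> 0 \<le> f w" and A: "A \<subseteq> S"
  shows "(\<lambda>(w, z). f w * p w z) summable_on A \<times> S"
proof (rule summable_on_SigmaI[where g = f])
  show "((\<lambda>z. (\<lambda>(w, z). f w * p w z) (w, z)) has_sum f w) S" if "w \<in> A" for w
    using has_sum_cmult_right[OF p_has_sum, of w "f w"] that A by auto
qed (use f subsetD[OF A] p_nonneg in auto)

lemma weight_summable:
  assumes f: "f summable_on A" "\<And>w. w \<in> A \<Longrightarrow> 0 \<le> f w" and A: "A \<subseteq> S" and z: "z \<in> S"
  shows "(\<lambda>w. f w * p w z) summable_on A"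
  by (rule summable_on_comparison_test[OF f(1)])
     (use f A z p_nonneg p_le_1 in \<open>auto intro!: mult_left_le\<close>)

text \<open>Fubini and the row sums of \<open>p\<close>: a step of the chain moves mass without loss.  This controls
  both the powers of the killed matrix and the contraction argument below.\<close>

lemma weight_has_sum:
  assumes f: "f summable_on A" "\<And>w. w \<in> A \<Longrightarrow> 0 \<le> f w" and A: "A \<subseteq> S"
  shows "((\<lambda>z. \<Sum>\<^sub>\<infinity>w\<in>A. f w * p w z) has_sum (\<Sum>\<^sub>\<infinity>w\<in>A. f w)) S"
proof -
  note sw = weight_joint_summable[OF assms]
  have "(\<lambda>(z, w). f w * p w z) summable_on S \<times> A"
    using sw by (subst summable_on_swap) auto
  then have "(\<lambda>z. \<Sum>\<^sub>\<infinity>w\<in>A. f w * p w z) summable_on S"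
    by (rule summable_on_Sigma_banach)
  moreover have "(\<Sum>\<^sub>\<infinity>z\<in>S. \<Sum>\<^sub>\<infinity>w\<in>A. f w * p w z) = (\<Sum>\<^sub>\<infinity>w\<in>A. \<Sum>\<^sub>\<infinity>z\<in>S. f w * p w z)"
    using infsum_swap_banach[OF sw] by simp
  moreover have "\<dots> = (\<Sum>\<^sub>\<infinity>w\<in>A. f w)"
    using A p_has_sum by (intro infsum_cong) (auto simp: infsum_cmult_right' infsumI subset_iff)
  ultimately show ?thesis by (simp add: has_sum_iff)
qed

text \<open>A step preserves the mass, and killing outside \<open>A\<close> can only reduce it.\<close>

lemma mpow_mass:
  assumes A: "A \<subseteq> S"
  shows "mpow A p n x summable_on S \<and> (\<Sum>\<^sub>\<infinity>z\<in>S. mpow A p n x z) \<le> 1"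
proof (induction n)
  case 0
  show ?case
  proof (cases "x \<in> S")
    case True
    have "mpow A p 0 x = (\<lambda>z. of_bool (x = z))" by auto
    then show ?thesis using of_bool_has_sum[OF True] by (auto simp: has_sum_iff)
  next
    case False
    then have *: "z \<in> S \<Longrightarrow> mpow A p 0 x z = 0" for z by auto
    show ?thesis using * by (auto simp: infsum_0 cong: summable_on_cong)
  qed
next
  case (Suc n)
  have nn: "w \<in> S \<Longrightarrow> 0 \<le> mpow A p n x w" for w by (rule mpow_nonneg[OF A])
  have s: "mpow A p n x summable_on A"
    using Suc A by (blast intro: summable_on_subset_banach)
  have "(mpow A p (Suc n) x has_sum (\<Sum>\<^sub>\<infinity>w\<in>A. mpow A p n x w)) S"
    using weight_has_sum[OF s nn[OF subsetD[OF A]] A] by (simp add: fun_eq_iff[symmetric] cong: has_sum_cong)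
  moreover have "(\<Sum>\<^sub>\<infinity>w\<in>A. mpow A p n x w) \<le> (\<Sum>\<^sub>\<infinity>w\<in>S. mpow A p n x w)"
    using s Suc A nn by (intro infsum_mono_neutral) auto
  ultimately show ?case using Suc by (auto simp: has_sum_iff simp del: mpow.simps)
qed

lemma mpow_summable: "A \<subseteq> S \<Longrightarrow> B \<subseteq> S \<Longrightarrow> mpow A p n x summable_on B"
  using mpow_mass by (blast intro: summable_on_subset_banach)

lemma mpow_sum_le_1: "A \<subseteq> S \<Longrightarrow> B \<subseteq> S \<Longrightarrow> (\<Sum>\<^sub>\<infinity>z\<in>B. mpow A p n x z) \<le> 1"
  using mpow_mass[of A n x] mpow_nonneg[of A]
  by (intro order.trans[OF infsum_mono_neutral[of _ B _ S]]) (auto simp: mpow_summable)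

lemma mpow_le_1: "A \<subseteq> S \<Longrightarrow> z \<in> S \<Longrightarrow> mpow A p n x z \<le> 1"
  using mpow_sum_le_1[of A "{z}"] by simp

text \<open>The \<open>q\<close>-potential without the normalisation by \<open>\<pi>\<close>, which cancels in all Martin kernels.  In
  this form an absorbing endpoint needs no separate treatment as second argument.\<close>

definition green :: "int set \<Rightarrow> int \<Rightarrow> int \<Rightarrow> real" where
  "green A x z = (\<Sum>n. q ^ n * mpow A p n x z)"

lemma q_power_summable: "summable (\<lambda>n. q ^ n)"
  using q_pos q_less_1 by (simp add: summable_geometric)

lemma green_terms_summable:
  assumes "A \<subseteq> S" "z \<in> S"
  shows "summable (\<lambda>n. q ^ n * mpow A p n x z)"
  by (rule summable_comparison_test'[OF q_power_summable, where N = 0])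
     (use assms mpow_nonneg mpow_le_1 q_pos in \<open>auto simp: abs_mult intro!: mult_left_le\<close>)

lemma green_eq_infsum:
  assumes "A \<subseteq> S" "z \<in> S"
  shows "green A x z = (\<Sum>\<^sub>\<infinity>n. q ^ n * mpow A p n x z)"
proof -
  have "(\<lambda>n. q ^ n * mpow A p n x z) summable_on UNIV"
    using green_terms_summable[OF assms] mpow_nonneg[OF assms] q_pos
    by (subst summable_on_UNIV_nonneg_real_iff) auto
  then show ?thesis
    unfolding green_def by (metis has_sum_imp_sums has_sum_infsum sums_unique)
qed

lemma green_nonneg: "A \<subseteq> S \<Longrightarrow> z \<in> S \<Longrightarrow> 0 \<le> green A x z"
  unfolding green_def using green_terms_summable mpow_nonneg q_pos
  by (intro suminf_nonneg) auto

lemma green_ge_of_bool: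
  assumes "A \<subseteq> S" "z \<in> S"
  shows "of_bool (x = z) \<le> green A x z"
  using sum_le_suminf[OF green_terms_summable[OF assms], of "{0}" x] mpow_nonneg[OF assms] q_pos
  by (simp add: green_def)

lemma green_le:
  assumes "A \<subseteq> S" "z \<in> S"
  shows "green A x z \<le> 1 / (1 - q)"
proof -
  have "green A x z \<le> (\<Sum>n. q ^ n)"
    unfolding green_def
    by (rule suminf_le[OF _ green_terms_summable[OF assms] q_power_summable])
       (use mpow_le_1[OF assms] q_pos in \<open>auto intro!: mult_left_le\<close>)
  then show ?thesis using q_pos q_less_1 by (simp add: suminf_geometric)
qed

lemma green_joint_summable:
  assumes A: "A \<subseteq> S" and B: "B \<subseteq> S"
  shows "(\<lambda>(n, z). q ^ n * mpow A p n x z) summable_on UNIV \<times> B"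
proof (rule summable_on_SigmaI)
  show "((\<lambda>z. (\<lambda>(n, z). q ^ n * mpow A p n x z) (n, z)) has_sum
     q ^ n * (\<Sum>\<^sub>\<infinity>z\<in>B. mpow A p n x z)) B" for n
    using mpow_summable[OF A B] by (auto intro!: has_sum_cmult_right)
  have nn: "0 \<le> (\<Sum>\<^sub>\<infinity>z\<in>B. mpow A p n x z)" for n
    using mpow_nonneg[OF A] B by (auto intro!: infsum_nonneg)
  have "summable (\<lambda>n. q ^ n * (\<Sum>\<^sub>\<infinity>z\<in>B. mpow A p n x z))"
    by (rule summable_comparison_test'[OF q_power_summable, where N = 0])
       (use nn mpow_sum_le_1[OF A B] q_pos in \<open>auto simp: abs_mult intro!: mult_left_le\<close>)
  then show "(\<lambda>n. q ^ n * (\<Sum>\<^sub>\<infinity>z\<in>B. mpow A p n x z)) summable_on UNIV"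
    using nn q_pos by (subst summable_on_UNIV_nonneg_real_iff) auto
qed (use assms mpow_nonneg q_pos in auto)

lemma green_summable:
  assumes A: "A \<subseteq> S" and B: "B \<subseteq> S"
  shows "green A x summable_on B"
proof -
  have "(\<lambda>(z, n). q ^ n * mpow A p n x z) summable_on B \<times> UNIV"
    using green_joint_summable[OF assms] by (subst summable_on_swap) auto
  then have "(\<lambda>z. \<Sum>\<^sub>\<infinity>n. q ^ n * mpow A p n x z) summable_on B"
    by (rule summable_on_Sigma_banach)
  moreover have "(\<lambda>z. \<Sum>\<^sub>\<infinity>n. q ^ n * mpow A p n x z) summable_on B \<longleftrightarrow> green A x summable_on B"
    using A B by (intro summable_on_cong) (auto simp: green_eq_infsum)
  ultimately show ?thesis by simp
qed

lemma green_sum: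
  assumes A: "A \<subseteq> S" and B: "B \<subseteq> S"
  shows "(\<lambda>n. q ^ n * (\<Sum>\<^sub>\<infinity>z\<in>B. mpow A p n x z)) sums (\<Sum>\<^sub>\<infinity>z\<in>B. green A x z)"
proof -
  note js = green_joint_summable[OF assms]
  have "(\<lambda>n. \<Sum>\<^sub>\<infinity>z\<in>B. q ^ n * mpow A p n x z) summable_on UNIV"
    using summable_on_Sigma_banach[OF js] .
  moreover have "(\<Sum>\<^sub>\<infinity>n. \<Sum>\<^sub>\<infinity>z\<in>B. q ^ n * mpow A p n x z) = (\<Sum>\<^sub>\<infinity>z\<in>B. green A x z)"
    using A B by (subst infsum_swap_banach[OF js]) (auto intro!: infsum_cong simp: green_eq_infsum)
  ultimately have "((\<lambda>n. \<Sum>\<^sub>\<infinity>z\<in>B. q ^ n * mpow A p n x z) has_sum (\<Sum>\<^sub>\<infinity>z\<in>B. green A x z)) UNIV"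
    by (simp add: has_sum_iff)
  then show ?thesis
    by (auto dest!: has_sum_imp_sums simp: infsum_cmult_right')
qed

lemma green_flow_summable:
  assumes "A \<subseteq> S" "B \<subseteq> S" "z \<in> S"
  shows "(\<lambda>w. green A x w * p w z) summable_on B"
  using assms by (intro weight_summable green_summable green_nonneg) auto

text \<open>Decomposition according to the last step of the path.\<close>

lemma green_forward:
  assumes A: "A \<subseteq> S" and z: "z \<in> S"
  shows "green A x z = of_bool (x = z) + q * (\<Sum>\<^sub>\<infinity>w\<in>A. green A x w * p w z)"
proof -
  note js = green_joint_summable[OF A A, of x]
  have js': "(\<lambda>(n, w). q ^ n * mpow A p n x w * p w z) summable_on UNIV \<times> A"
    by (rule summable_on_comparison_test[OF js])
       (use subsetD[OF A] z mpow_nonneg[OF A] p_nonneg p_le_1 q_pos in \<open>auto intro!: mult_left_le mult_nonneg_nonneg\<close>)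
  have eq: "(\<Sum>\<^sub>\<infinity>w\<in>A. q ^ n * mpow A p n x w * p w z) = q ^ n * mpow A p (Suc n) x z" for n
    by (simp add: mult.assoc infsum_cmult_right')
  have "(\<Sum>\<^sub>\<infinity>n. \<Sum>\<^sub>\<infinity>w\<in>A. q ^ n * mpow A p n x w * p w z) = (\<Sum>\<^sub>\<infinity>w\<in>A. green A x w * p w z)"
    by (subst infsum_swap_banach[OF js'])
      (auto intro!: infsum_cong simp: green_eq_infsum[OF A subsetD[OF A]] infsum_cmult_left')
  moreover have "(\<lambda>n. \<Sum>\<^sub>\<infinity>w\<in>A. q ^ n * mpow A p n x w * p w z) summable_on UNIV"
    using summable_on_Sigma_banach[OF js'] .
  ultimately have "((\<lambda>n. \<Sum>\<^sub>\<infinity>w\<in>A. q ^ n * mpow A p n x w * p w z) has_sum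
      (\<Sum>\<^sub>\<infinity>w\<in>A. green A x w * p w z)) UNIV"
    by (simp add: has_sum_iff)
  then have "(\<lambda>n. q ^ n * mpow A p (Suc n) x z) sums (\<Sum>\<^sub>\<infinity>w\<in>A. green A x w * p w z)"
    unfolding eq by (rule has_sum_imp_sums)
  then have "(\<lambda>n. q ^ Suc n * mpow A p (Suc n) x z) sums (q * (\<Sum>\<^sub>\<infinity>w\<in>A. green A x w * p w z))"
    by (auto dest: sums_mult[where c = q] simp: mult.assoc)
  then have "(\<lambda>n. q ^ n * mpow A p n x z) sums
      (q * (\<Sum>\<^sub>\<infinity>w\<in>A. green A x w * p w z) + q ^ 0 * mpow A p 0 x z)"
    by (subst (asm) sums_Suc_iff) simp
  then show ?thesis by (simp add: green_def sums_iff)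
qed

text \<open>By \<open>weight_has_sum\<close> the map \<open>d \<mapsto> q d P\<close> shrinks the norm \<open>\<Sum>w. \<bar>d w\<bar>\<close> by the factor \<open>q < 1\<close>,
  so it has no other summable fixed point than \<open>0\<close>.\<close>

lemma contraction_zero:
  assumes A: "A \<subseteq> S" and d: "(\<lambda>w. \<bar>d w\<bar>) summable_on A"
    and eq: "\<And>z. z \<in> A \<Longrightarrow> d z = q * (\<Sum>\<^sub>\<infinity>w\<in>A. d w * p w z)"
    and z: "z \<in> A"
  shows "d z = 0"
proof -
  let ?D = "\<Sum>\<^sub>\<infinity>w\<in>A. \<bar>d w\<bar>"
  have hs: "((\<lambda>z. \<Sum>\<^sub>\<infinity>w\<in>A. \<bar>d w\<bar> * p w z) has_sum ?D) S"
    using weight_has_sum[OF d _ A] by simp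
  have le: "\<bar>d z\<bar> \<le> q * (\<Sum>\<^sub>\<infinity>w\<in>A. \<bar>d w\<bar> * p w z)" if "z \<in> A" for z
  proof -
    have s: "(\<lambda>w. \<bar>d w\<bar> * p w z) summable_on A"
      using that A by (intro weight_summable d) auto
    have n: "norm (d w * p w z) = \<bar>d w\<bar> * p w z" if "w \<in> A" for w
      using p_nonneg[of w z] subsetD[OF A] that \<open>z \<in> A\<close> by (simp add: abs_mult)
    then have "(\<lambda>w. norm (d w * p w z)) summable_on A"
      using s by (simp cong: summable_on_cong)
    then have "\<bar>\<Sum>\<^sub>\<infinity>w\<in>A. d w * p w z\<bar> \<le> (\<Sum>\<^sub>\<infinity>w\<in>A. norm (d w * p w z))"
      using norm_infsum_bound[of "\<lambda>w. d w * p w z" A] by simp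
    also have "\<dots> = (\<Sum>\<^sub>\<infinity>w\<in>A. \<bar>d w\<bar> * p w z)"
      by (rule infsum_cong) (rule n)
    finally show ?thesis
      using eq[OF that] q_pos by (simp add: abs_mult)
  qed
  \<comment> \<open>The sum over \<open>z\<close> is enlarged from \<open>A\<close> to \<open>S\<close>, where the mass of a step is known exactly.\<close>
  have "?D \<le> (\<Sum>\<^sub>\<infinity>z\<in>S. q * (\<Sum>\<^sub>\<infinity>w\<in>A. \<bar>d w\<bar> * p w z))"
  proof (rule infsum_mono_neutral[OF d])
    show "(\<lambda>z. q * (\<Sum>\<^sub>\<infinity>w\<in>A. \<bar>d w\<bar> * p w z)) summable_on S"
      using hs by (auto intro!: summable_on_cmult_right simp: has_sum_iff)
    show "0 \<le> q * (\<Sum>\<^sub>\<infinity>w\<in>A. \<bar>d w\<bar> * p w z)" if "z \<in> S - A" for z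
      using that A q_pos by (intro mult_nonneg_nonneg infsum_nonneg p_nonneg) auto
  qed (use A le in auto)
  also have "\<dots> = q * ?D"
    using hs by (simp add: has_sum_iff infsum_cmult_right')
  finally have "(1 - q) * ?D \<le> 0" by (simp add: algebra_simps)
  then have "?D \<le> 0" using q_less_1 by (simp add: mult_le_0_iff)
  moreover have "\<bar>d z\<bar> \<le> ?D"
    using finite_sum_le_infsum[OF d, of "{z}"] z by auto
  ultimately show ?thesis by simp
qed

text \<open>The paths from \<open>x\<close> to \<open>z\<close> through \<open>y\<close> have weight \<open>g(x,y) g(y,z) / g(y,y)\<close>.  Instead of
  decomposing paths, the proof compares equations: as functions of \<open>z\<close>, both sides satisfy the
  forward equation on \<open>A - {y}\<close> with the same source, since the terms with last step from \<open>y\<close>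
  cancel on the right.  By \<open>contraction_zero\<close> they agree on \<open>A - {y}\<close>, and the forward equation
  once more carries this over to the points \<open>z\<close> outside \<open>A\<close>.\<close>

lemma green_kill_point:
  assumes A: "A \<subseteq> S" and y: "y \<in> A" and z: "z \<in> S" "z \<noteq> y"
  shows "green (A - {y}) x z = green A x z - green A x y * green A y z / green A y y"
proof -
  let ?B = "A - {y}"
  define c where "c = green A x y / green A y y"
  define d where "d z = green ?B x z - green A x z + c * green A y z" for z
  have B: "?B \<subseteq> S" and yS: "y \<in> S" using A y by auto
  have yy: "green A y y > 0"
    using green_ge_of_bool[OF A yS, of y] by simp
  have split: "(\<Sum>\<^sub>\<infinity>w\<in>A. green A v w * p w z)
      = green A v y * p y z + (\<Sum>\<^sub>\<infinity>w\<in>?B. green A v w * p w z)" if "z \<in> S" for v z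
    using infsum_insert[of "\<lambda>w. green A v w * p w z" ?B y] green_flow_summable[OF A B that, of v] y
    by (simp add: insert_absorb)
  have d_eq: "d z = q * (\<Sum>\<^sub>\<infinity>w\<in>?B. d w * p w z)" if "z \<in> S" "z \<noteq> y" for z
  proof -
    note s1 = green_flow_summable[OF B B that(1), of x]
      and s2 = green_flow_summable[OF A B that(1)]
    have "((\<lambda>w. green ?B x w * p w z + (- 1) * (green A x w * p w z) + c * (green A y w * p w z))
      has_sum (\<Sum>\<^sub>\<infinity>w\<in>?B. green ?B x w * p w z) + (- 1) * (\<Sum>\<^sub>\<infinity>w\<in>?B. green A x w * p w z)
        + c * (\<Sum>\<^sub>\<infinity>w\<in>?B. green A y w * p w z)) ?B"
      using s1 s2[of x] s2[of y] by (intro has_sum_add has_sum_cmult_right has_sum_infsum)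
    also have "(\<lambda>w. green ?B x w * p w z + (- 1) * (green A x w * p w z) + c * (green A y w * p w z))
      = (\<lambda>w. d w * p w z)"
      by (simp add: d_def algebra_simps)
    finally have D: "(\<Sum>\<^sub>\<infinity>w\<in>?B. d w * p w z) = (\<Sum>\<^sub>\<infinity>w\<in>?B. green ?B x w * p w z)
        - (\<Sum>\<^sub>\<infinity>w\<in>?B. green A x w * p w z) + c * (\<Sum>\<^sub>\<infinity>w\<in>?B. green A y w * p w z)"
      by (simp add: infsumI)
    have "green A x y = c * green A y y"
      using yy by (simp add: c_def)
    then show ?thesis
      using d_def[of z] green_forward[OF B that(1), of x] green_forward[OF A that(1), of x]
        green_forward[OF A that(1), of y] split[OF that(1), of x] split[OF that(1), of y] that(2)
      unfolding D by (simp add: algebra_simps)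
  qed
  have "(\<lambda>w. green ?B x w + green A x w + c * green A y w) summable_on ?B"
    using A B by (intro summable_on_add summable_on_cmult_right green_summable) auto
  moreover have "\<bar>d w\<bar> \<le> green ?B x w + green A x w + c * green A y w" if "w \<in> ?B" for w
  proof -
    have "w \<in> S" and "0 \<le> c"
      using that A yy green_nonneg[OF A yS, of x] by (auto simp: c_def)
    then show ?thesis
      using green_nonneg[OF B, of w x] green_nonneg[OF A, of w x] green_nonneg[OF A, of w y]
        mult_nonneg_nonneg[of c "green A y w"]
      unfolding d_def by linarith
  qed
  ultimately have "(\<lambda>w. \<bar>d w\<bar>) summable_on ?B"
    by (rule summable_on_comparison_test) auto
  then have "d w = 0" if "w \<in> ?B" for w
    by (rule contraction_zero[OF B _ _ that]) (rule d_eq; use B in auto)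
  then have "d z = q * (\<Sum>\<^sub>\<infinity>w\<in>?B. 0)"
    unfolding d_eq[OF z] by (intro arg_cong[where f = "(*) q"] infsum_cong) auto
  then show ?thesis by (simp add: d_def c_def)
qed

text \<open>The powers are defined by appending a last step; reversing time for the dual matrix requires
  the decomposition at the first step.\<close>

lemma mpow_Suc_left:
  assumes A: "A \<subseteq> S" and x: "x \<in> A" and y: "y \<in> A"
  shows "mpow A p (Suc n) x y = (\<Sum>\<^sub>\<infinity>z\<in>A. p x z * mpow A p n z y)"
  using y
proof (induction n arbitrary: y)
  case 0
  have "((\<lambda>w. of_bool (x = w) * p w y) has_sum p x y) A"
    by (rule has_sum_finite_neutralI[where B = "{x}"]) (use x in auto)
  moreover have "((\<lambda>z. p x z * of_bool (z = y)) has_sum p x y) A"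
    by (rule has_sum_finite_neutralI[where B = "{y}"]) (use 0 in auto)
  ultimately show ?case by (simp add: infsumI)
next
  case (Suc n)
  have js: "(\<lambda>(z, w). p x z * (mpow A p n z w * p w y)) summable_on A \<times> A"
  proof (rule summable_on_SigmaI)
    show "((\<lambda>w. (\<lambda>(z, w). p x z * (mpow A p n z w * p w y)) (z, w)) has_sum
        p x z * mpow A p (Suc n) z y) A" for z
      using A Suc.prems mpow_nonneg[OF A]
      by (auto intro!: has_sum_cmult_right has_sum_infsum weight_summable mpow_summable)
    show "(\<lambda>z. p x z * mpow A p (Suc n) z y) summable_on A"
    proof (rule summable_on_comparison_test)
      show "p x summable_on A"
        using p_has_sum[of x] A x by (auto simp: has_sum_iff intro: summable_on_subset_banach)
    qed (use A x Suc.prems mpow_nonneg[OF A, of y "Suc n"] mpow_le_1[OF A, of y "Suc n"] p_nonneg[of x] subsetD[OF A]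
          in \<open>auto intro!: mult_left_le mult_nonneg_nonneg simp del: mpow.simps\<close>)
  qed (use subsetD[OF A] x Suc.prems mpow_nonneg[OF A] p_nonneg in \<open>auto intro!: mult_nonneg_nonneg\<close>)
  have "mpow A p (Suc (Suc n)) x y = (\<Sum>\<^sub>\<infinity>w\<in>A. (\<Sum>\<^sub>\<infinity>z\<in>A. p x z * mpow A p n z w) * p w y)"
    unfolding mpow.simps(2)[of A p "Suc n"] by (rule infsum_cong) (simp only: Suc.IH)
  also have "\<dots> = (\<Sum>\<^sub>\<infinity>w\<in>A. \<Sum>\<^sub>\<infinity>z\<in>A. p x z * (mpow A p n z w * p w y))"
    by (simp add: infsum_cmult_left' flip: mult.assoc)
  also have "\<dots> = (\<Sum>\<^sub>\<infinity>z\<in>A. \<Sum>\<^sub>\<infinity>w\<in>A. p x z * (mpow A p n z w * p w y))"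
    using infsum_swap_banach[OF js] by simp
  also have "\<dots> = (\<Sum>\<^sub>\<infinity>z\<in>A. p x z * mpow A p (Suc n) z y)"
    by (simp add: infsum_cmult_right')
  finally show ?case .
qed

end

section \<open>Exit times of the chain\<close>

text \<open>Countable additivity as an unordered sum over an arbitrary countable index set, as needed for
  sums over states and over finite histories.\<close>

lemma (in finite_measure) measure_UN_has_sum:
  assumes sets: "\<And>i. i \<in> I \<Longrightarrow> A i \<in> sets M" and I: "countable I" and disj: "disjoint_family_on A I"
  shows "((\<lambda>i. measure M (A i)) has_sum measure M (\<Union>i\<in>I. A i)) I"
proof -
  have "(\<integral>\<^sup>+i. ennreal (measure M (A i)) \<partial>count_space I) = ennreal (measure M (\<Union>i\<in>I. A i))"
    using emeasure_UN_countable[OF sets I disj] by (simp add: emeasure_eq_measure)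
  then have int: "integrable (count_space I) (\<lambda>i. measure M (A i))"
    and eq: "(\<integral>i. measure M (A i) \<partial>count_space I) = measure M (\<Union>i\<in>I. A i)"
    by (auto intro!: integrableI_nonneg simp: integral_eq_nn_integral)
  have abs: "Infinite_Set_Sum.abs_summable_on (\<lambda>i. measure M (A i)) I"
    using int by (simp add: Infinite_Set_Sum.abs_summable_on_def)
  then have "(\<lambda>i. measure M (A i)) summable_on I"
    by (simp flip: abs_summable_equivalent)
  moreover have "(\<Sum>\<^sub>\<infinity>i\<in>I. measure M (A i)) = measure M (\<Union>i\<in>I. A i)"
    using infsetsum_infsum[OF abs] eq by (simp add: infsetsum_def)
  ultimately show ?thesis by (simp add: has_sum_iff)
qed

text \<open>The geometric sum over \<open>n < T\<close> gives \<open>1 - q\<^sup>T\<close>; it remains true for \<open>T = \<infinity>\<close> because \<open>q < 1\<close>.\<close>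

lemma epow_hitting_time:
  assumes q: "0 < q" "q < 1"
  shows "epow q (hitting_time X C \<omega>) = 1 - (1 - q) * (\<Sum>n. q ^ n * of_bool (\<forall>i\<le>n. X i \<omega> \<notin> C))"
proof (cases "\<exists>n. X n \<omega> \<in> C")
  case False
  then have "hitting_time X C \<omega> = \<infinity>" by (simp add: hitting_time_def Inf_enat_def)
  moreover have "lim (\<lambda>n. q ^ n) = 0" using q by (intro limI LIMSEQ_power_zero) auto
  ultimately show ?thesis using q False by (simp add: epow_def suminf_geometric)
next
  case True
  define N where "N = (LEAST n. X n \<omega> \<in> C)"
  have N: "X N \<omega> \<in> C" unfolding N_def using True by (rule LeastI_ex)
  have less: "X n \<omega> \<notin> C" if "n < N" for n using not_less_Least[of n] that by (auto simp: N_def)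
  have "hitting_time X C \<omega> = enat N"
    unfolding hitting_time_def
  proof (rule antisym)
    show "Inf {enat n |n. X n \<omega> \<in> C} \<le> enat N" using N by (intro Inf_lower) auto
    show "enat N \<le> Inf {enat n |n. X n \<omega> \<in> C}"
      using less by (intro Inf_greatest) (auto intro: leI)
  qed
  moreover have "(\<Sum>n. q ^ n * of_bool (\<forall>i\<le>n. X i \<omega> \<notin> C)) = (\<Sum>n<N. q ^ n)"
  proof -
    have "(\<forall>i\<le>n. X i \<omega> \<notin> C) \<longleftrightarrow> n < N" for n using N less by (meson not_less order.strict_trans1)
    then show ?thesis by (subst suminf_finite[of "{..<N}"]) auto
  qed
  moreover have "(\<Sum>n<N. q ^ n) = (1 - q ^ N) / (1 - q)"
    using q by (simp add: sum_gp_strict)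
  ultimately show ?thesis using q by (simp add: epow_def)
qed

context killed_kernel
begin

context
  fixes Pr :: "int \<Rightarrow> 'w measure" and X :: "nat \<Rightarrow> 'w \<Rightarrow> int" and x :: int
  assumes chain: "markov_chain S p Pr X" and x: "x \<in> S"
begin

lemma law_prob_space: "prob_space (Pr x)"
  using chain x by (auto simp: markov_chain_def)

interpretation law: prob_space "Pr x"
  by (rule law_prob_space)

lemma X_measurable: "X n \<in> measurable (Pr x) (count_space UNIV)"
proof -
  have "X n \<in> measurable (Pr x) (count_space S)" using chain x by (auto simp: markov_chain_def)
  then show ?thesis by (rule measurable_compose) simp
qed

lemma X_in_S: "\<omega> \<in> space (Pr x) \<Longrightarrow> X n \<omega> \<in> S"
proof -
  have "X n \<in> measurable (Pr x) (count_space S)" using chain x by (auto simp: markov_chain_def)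
  then show "\<omega> \<in> space (Pr x) \<Longrightarrow> X n \<omega> \<in> S" by (auto dest: measurable_space)
qed

lemmas [measurable] = X_measurable

lemma path_step:
  assumes "\<And>i. s i \<in> S"
  shows "measure (Pr x) {\<omega>\<in>space (Pr x). \<forall>i\<le>Suc n. X i \<omega> = s i} =
    measure (Pr x) {\<omega>\<in>space (Pr x). \<forall>i\<le>n. X i \<omega> = s i} * p (s n) (s (Suc n))"
  using chain x assms by (auto simp: markov_chain_def)

text \<open>The Markov property is given for single trajectories.  The event on the left is the disjoint
  union over the countably many histories in \<open>B\<close> that end in \<open>y\<close>, and each of them contributes
  the same factor \<open>p y z\<close>.\<close>

lemma stay_step:
  assumes B: "B \<subseteq> S" and y: "y \<in> B" and z: "z \<in> S"
  shows "measure (Pr x) {\<omega>\<in>space (Pr x). (\<forall>i\<le>n. X i \<omega> \<in> B) \<and> X n \<omega> = y \<and> X (Suc n) \<omega> = z} =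
    measure (Pr x) {\<omega>\<in>space (Pr x). (\<forall>i\<le>n. X i \<omega> \<in> B) \<and> X n \<omega> = y} * p y z"
proof -
  define I where "I = {s \<in> {..n} \<rightarrow>\<^sub>E B. s n = y}"
  define t where "t s i = (if i \<le> n then s i else z)" for s :: "nat \<Rightarrow> int" and i
  let ?E = "\<lambda>s. {\<omega>\<in>space (Pr x). \<forall>i\<le>n. X i \<omega> = s i}"
  let ?F = "\<lambda>s. {\<omega>\<in>space (Pr x). \<forall>i\<le>Suc n. X i \<omega> = t s i}"
  have cnt: "countable I"
    unfolding I_def by (rule countable_subset[OF _ countable_PiE[of "{..n}" "\<lambda>_. B"]]) auto
  have disj: "disjoint_family_on ?E I" "disjoint_family_on ?F I"
  proof -
    have "s = s'" if "s \<in> I" "s' \<in> I" "\<forall>i\<le>n. s i = s' i" for s s'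
      using that by (intro PiE_ext[of s "{..n}" "\<lambda>_. B" s']) (auto simp: I_def)
    then show "disjoint_family_on ?E I" "disjoint_family_on ?F I"
      by (fastforce simp: disjoint_family_on_def t_def)+
  qed
  have hist: "restrict (\<lambda>i. X i \<omega>) {..n} \<in> I" if "\<forall>i\<le>n. X i \<omega> \<in> B" "X n \<omega> = y" for \<omega>
    using that by (auto simp: I_def)
  have E: "(\<Union>s\<in>I. ?E s) = {\<omega>\<in>space (Pr x). (\<forall>i\<le>n. X i \<omega> \<in> B) \<and> X n \<omega> = y}"
  proof (intro equalityI subsetI)
    fix \<omega> assume "\<omega> \<in> {\<omega>\<in>space (Pr x). (\<forall>i\<le>n. X i \<omega> \<in> B) \<and> X n \<omega> = y}"
    then show "\<omega> \<in> (\<Union>s\<in>I. ?E s)" using hist[of \<omega>] by (intro UN_I[of "restrict (\<lambda>i. X i \<omega>) {..n}"]) auto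
  qed (auto simp: I_def PiE_iff)
  have F: "(\<Union>s\<in>I. ?F s) = {\<omega>\<in>space (Pr x). (\<forall>i\<le>n. X i \<omega> \<in> B) \<and> X n \<omega> = y \<and> X (Suc n) \<omega> = z}"
  proof (intro equalityI subsetI)
    fix \<omega> assume "\<omega> \<in> {\<omega>\<in>space (Pr x). (\<forall>i\<le>n. X i \<omega> \<in> B) \<and> X n \<omega> = y \<and> X (Suc n) \<omega> = z}"
    then show "\<omega> \<in> (\<Union>s\<in>I. ?F s)" using hist[of \<omega>]
      by (intro UN_I[of "restrict (\<lambda>i. X i \<omega>) {..n}"]) (auto simp: t_def le_Suc_eq)
  qed (auto simp: I_def PiE_iff t_def)
  have "measure (Pr x) (?F s) = measure (Pr x) (?E s) * p y z" if "s \<in> I" for s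
  proof -
    have "t s i \<in> S" for i using that B z by (auto simp: t_def I_def PiE_iff)
    then have "measure (Pr x) (?F s)
        = measure (Pr x) {\<omega>\<in>space (Pr x). \<forall>i\<le>n. X i \<omega> = t s i} * p (t s n) (t s (Suc n))"
      by (rule path_step)
    then show ?thesis using that by (simp add: t_def I_def)
  qed
  then have "((\<lambda>s. measure (Pr x) (?E s) * p y z) has_sum measure (Pr x) (\<Union>s\<in>I. ?F s)) I"
    using law.measure_UN_has_sum[OF _ cnt disj(2)] by (simp cong: has_sum_cong)
  moreover have "((\<lambda>s. measure (Pr x) (?E s) * p y z) has_sum measure (Pr x) (\<Union>s\<in>I. ?E s) * p y z) I"
    by (intro has_sum_cmult_left law.measure_UN_has_sum cnt disj) simp
  ultimately show ?thesis
    unfolding E F by (rule has_sum_unique)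
qed

lemma stay_measure:
  assumes B: "B \<subseteq> S" and xB: "x \<in> B" and y: "y \<in> B"
  shows "measure (Pr x) {\<omega>\<in>space (Pr x). (\<forall>i\<le>n. X i \<omega> \<in> B) \<and> X n \<omega> = y} = mpow B p n x y"
  using y
proof (induction n arbitrary: y)
  case 0
  have start: "measure (Pr x) {\<omega>\<in>space (Pr x). X 0 \<omega> = x} = 1"
    using chain x by (auto simp: markov_chain_def)
  have eq: "{\<omega>\<in>space (Pr x). (\<forall>i\<le>0. X i \<omega> \<in> B) \<and> X 0 \<omega> = y} = {\<omega>\<in>space (Pr x). X 0 \<omega> = y}"
    using 0 by auto
  have "measure (Pr x) {\<omega>\<in>space (Pr x). X 0 \<omega> = y} = 0" if "y \<noteq> x"
  proof -
    have "AE \<omega> in Pr x. X 0 \<omega> = x"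
      using law.AE_in_set_eq_1[of "{\<omega>\<in>space (Pr x). X 0 \<omega> = x}"] start by auto
    then have "AE \<omega> in Pr x. \<not> X 0 \<omega> = y" using that by auto
    then show ?thesis by (subst law.prob_eq_0) auto
  qed
  then show ?case using start unfolding eq by (cases "x = y") auto
next
  case (Suc n)
  let ?E = "\<lambda>z y. {\<omega>\<in>space (Pr x). (\<forall>i\<le>n. X i \<omega> \<in> B) \<and> X n \<omega> = z \<and> X (Suc n) \<omega> = y}"
  have eq: "{\<omega>\<in>space (Pr x). (\<forall>i\<le>Suc n. X i \<omega> \<in> B) \<and> X (Suc n) \<omega> = y} = (\<Union>z\<in>B. ?E z y)"
    using Suc.prems by (auto simp: le_Suc_eq)
  have "((\<lambda>z. measure (Pr x) (?E z y)) has_sum measure (Pr x) (\<Union>z\<in>B. ?E z y)) B"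
    by (rule law.measure_UN_has_sum) (auto simp: disjoint_family_on_def)
  moreover have "measure (Pr x) (?E z y) = mpow B p n x z * p z y" if "z \<in> B" for z
    using stay_step[OF B that, of y n] Suc that B by auto
  ultimately have "((\<lambda>z. mpow B p n x z * p z y) has_sum measure (Pr x) (\<Union>z\<in>B. ?E z y)) B"
    by (simp cong: has_sum_cong)
  then show ?case unfolding eq by (simp add: infsumI)
qed

lemma survival_measure:
  assumes B: "B \<subseteq> S" and xB: "x \<in> B"
  shows "measure (Pr x) {\<omega>\<in>space (Pr x). \<forall>i\<le>n. X i \<omega> \<in> B} = (\<Sum>\<^sub>\<infinity>y\<in>B. mpow B p n x y)"
proof -
  let ?E = "\<lambda>y. {\<omega>\<in>space (Pr x). (\<forall>i\<le>n. X i \<omega> \<in> B) \<and> X n \<omega> = y}"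
  have "((\<lambda>y. measure (Pr x) (?E y)) has_sum measure (Pr x) (\<Union>y\<in>B. ?E y)) B"
    by (rule law.measure_UN_has_sum) (auto simp: disjoint_family_on_def)
  moreover have "(\<Union>y\<in>B. ?E y) = {\<omega>\<in>space (Pr x). \<forall>i\<le>n. X i \<omega> \<in> B}" by auto
  ultimately show ?thesis
    using stay_measure[OF B xB] by (simp add: infsumI cong: has_sum_cong)
qed

text \<open>Integrate \<open>epow_hitting_time\<close> term by term.  The event that \<open>C\<close> is not hit up to time \<open>n\<close> has
  the probability of surviving \<open>n\<close> steps of the chain killed outside \<open>S - C\<close>.\<close>

lemma expectation_epow_hitting_time:
  assumes xC: "x \<notin> C"
  shows "(\<integral>\<omega>. epow q (hitting_time X C \<omega>) \<partial>Pr x) = 1 - (1 - q) * (\<Sum>\<^sub>\<infinity>y\<in>S - C. green (S - C) x y)"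
proof -
  let ?A = "\<lambda>n. {\<omega>\<in>space (Pr x). \<forall>i\<le>n. X i \<omega> \<in> S - C}"
  let ?f = "\<lambda>n \<omega>. q ^ n * indicat_real (?A n) \<omega>"
  have f_le: "norm (?f n \<omega>) \<le> q ^ n" for n \<omega>
    using q_pos by (auto simp: abs_mult split: split_indicator)
  have int: "integrable (Pr x) (?f n)" for n
    by (intro integrable_mult_right integrable_real_indicator) (auto simp: law.emeasure_eq_measure)
  have int_f: "(\<integral>\<omega>. ?f n \<omega> \<partial>Pr x) = q ^ n * (\<Sum>\<^sub>\<infinity>y\<in>S - C. mpow (S - C) p n x y)" for n
    using survival_measure[of "S - C" n] x xC by (simp add: Int_absorb1)
  have int_norm: "(\<integral>\<omega>. norm (?f n \<omega>) \<partial>Pr x) = (\<integral>\<omega>. ?f n \<omega> \<partial>Pr x)" for n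
    using q_pos by (intro Bochner_Integration.integral_cong) (auto simp: abs_mult)
  have summ: "summable (\<lambda>n. norm (?f n \<omega>))" for \<omega>
    by (rule summable_comparison_test'[OF q_power_summable, where N = 0]) (use f_le in auto)
  have summ_int: "summable (\<lambda>n. \<integral>\<omega>. norm (?f n \<omega>) \<partial>Pr x)"
    unfolding int_norm int_f using green_sum[of "S - C" "S - C" x] by (auto simp: sums_iff)
  have "(\<lambda>n. \<integral>\<omega>. ?f n \<omega> \<partial>Pr x) sums (\<integral>\<omega>. (\<Sum>n. ?f n \<omega>) \<partial>Pr x)"
    and int_suminf: "integrable (Pr x) (\<lambda>\<omega>. \<Sum>n. ?f n \<omega>)"
    using sums_integral[OF int _ summ_int] integrable_suminf[OF int _ summ_int] summ by auto
  then have "(\<integral>\<omega>. (\<Sum>n. ?f n \<omega>) \<partial>Pr x) = (\<Sum>\<^sub>\<infinity>y\<in>S - C. green (S - C) x y)"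
    unfolding int_f using green_sum[of "S - C" "S - C" x] sums_unique2 by auto
  moreover have "epow q (hitting_time X C \<omega>) = 1 - (1 - q) * (\<Sum>n. ?f n \<omega>)"
    if "\<omega> \<in> space (Pr x)" for \<omega>
  proof -
    have "?f n \<omega> = q ^ n * of_bool (\<forall>i\<le>n. X i \<omega> \<notin> C)" for n
      using that X_in_S[OF that] by (auto simp: indicator_def)
    then show ?thesis by (simp only: epow_hitting_time[OF q_pos q_less_1])
  qed
  then have "(\<integral>\<omega>. epow q (hitting_time X C \<omega>) \<partial>Pr x) = (\<integral>\<omega>. 1 - (1 - q) * (\<Sum>n. ?f n \<omega>) \<partial>Pr x)"
    by (intro Bochner_Integration.integral_cong) auto
  ultimately show ?thesis using int_suminf by (simp add: law.prob_space)
qed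

end

end

section \<open>Passages of an upward skip-free chain\<close>

locale skip_free_kernel = killed_kernel "states E \<rr>" p q
  for E :: "int set" and \<rr> :: "int extended" and p q +
  fixes \<ll> :: "int extended" and \<pi> :: "int \<Rightarrow> real" and \<oo> :: int
  assumes chain: "skip_free_class_inf E \<ll> \<rr> p"
    and \<pi>_pos: "\<And>y. y \<in> E \<Longrightarrow> 0 < \<pi> y"
    and ref_in: "\<oo> \<in> E"
begin

abbreviation S where "S \<equiv> states E \<rr>"

lemma E_subset_S: "E \<subseteq> S"
  by (auto simp: states_def)

lemma end_not_in_E: "Fin k = \<rr> \<Longrightarrow> k \<notin> E"
  using chain by (auto simp: skip_free_class_inf_def skip_free_class_def)

lemma E_bounds:
  assumes "x \<in> E"
  shows "\<ll> \<le> Fin x" "Fin x < \<rr>"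
proof -
  have "\<ll> \<le> Fin x" "Fin x \<le> \<rr>"
    using chain assms by (auto simp: skip_free_class_inf_def skip_free_class_def int_interval_def)
  then show "\<ll> \<le> Fin x" "Fin x < \<rr>"
    using end_not_in_E[of x] assms by (auto simp: order.strict_iff_order)
qed

lemma E_I: "\<ll> < Fin x \<Longrightarrow> Fin x < \<rr> \<Longrightarrow> x \<in> E"
  using chain by (auto simp: skip_free_class_inf_def skip_free_class_def int_interval_def)

lemma S_cases: "z \<in> S \<Longrightarrow> z \<in> E \<or> \<rr> = Fin z \<and> z \<notin> E"
  by (auto simp: states_def absorbing_end_def)

lemma S_I: "Fin z = \<rr> \<Longrightarrow> z \<in> S"
  by (auto simp: states_def absorbing_end_def)

lemma S_le: "z \<in> S \<Longrightarrow> Fin z \<le> \<rr>"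
  using S_cases E_bounds(2) by fastforce

lemma S_interval:
  assumes "x \<in> S" "z \<in> S" "x \<le> w" "w < z"
  shows "w \<in> E"
proof -
  have "Fin w < Fin z" using assms by simp
  then have wr: "Fin w < \<rr>" using S_le[OF assms(2)] by (rule order.strict_trans2)
  have x: "x \<in> E" using assms S_cases[of x] wr by auto
  show ?thesis
  proof (cases "w = x")
    case False
    then have "Fin x < Fin w" using assms by simp
    then show ?thesis using order.strict_trans1[OF E_bounds(1)[OF x]] wr by (intro E_I) auto
  qed (use x in simp)
qed

lemma up_pos: "x \<in> E \<Longrightarrow> 0 < p x (x + 1)"
  using chain E_bounds(2)
  by (auto simp: skip_free_class_inf_def skip_free_class_def upward_skip_free_def)

lemma skip_free:
  assumes "x \<in> E" "z \<in> S" "x + 2 \<le> z"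
  shows "p x z = 0"
proof -
  have "\<forall>y\<ge>2. x + y \<in> S \<longrightarrow> p x (x + y) = 0"
    using chain assms(1)
    by (auto simp: skip_free_class_inf_def skip_free_class_def upward_skip_free_def)
  from this[rule_format, of "z - x"] show ?thesis using assms by simp
qed

text \<open>Covers \<open>E\<close> and the sets \<open>above E y\<close>, so that the passage formulas below hold for the chain
  itself and for the chain killed at or below \<open>y\<close>.\<close>

definition up_closed :: "int set \<Rightarrow> bool" where
  "up_closed A \<longleftrightarrow> A \<subseteq> E \<and> (\<forall>w\<in>A. \<forall>v\<in>E. w \<le> v \<longrightarrow> v \<in> A)"

lemma up_closed_E: "up_closed E" and up_closed_above: "up_closed (above E b)"
  by (auto simp: up_closed_def above_def)

lemma up_closed_subset: "up_closed A \<Longrightarrow> A \<subseteq> S"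
  using E_subset_S by (auto simp: up_closed_def)

lemma above_subset_S: "above E y \<subseteq> S"
  using E_subset_S by (auto simp: above_def)

lemma green_self_pos: "A \<subseteq> S \<Longrightarrow> y \<in> S \<Longrightarrow> 0 < green A y y"
  using green_ge_of_bool[of A y y] by simp

text \<open>A path that ends above \<open>y\<close> and visits a point below \<open>y\<close> has to visit \<open>y\<close> afterwards.  Avoiding
  \<open>y\<close> therefore means staying above \<open>y\<close>.\<close>

lemma green_kill_above:
  assumes A: "up_closed A" and y: "y \<in> A" and z: "z \<in> S" "y < z"
  shows "green (above E y) x z = green A x z - green A x y * green A y z / green A y y"
proof -
  have "mpow (A - {y}) p n x z = mpow (above E y) p n x z" for n
    by (rule mpow_no_entrance[where Z = "{z \<in> S. y < z}"])
       (use A y z E_subset_S in \<open>auto simp: up_closed_def above_def intro!: skip_free\<close>)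
  then have "green (above E y) x z = green (A - {y}) x z"
    by (simp add: green_def)
  then show ?thesis
    using green_kill_point[OF up_closed_subset[OF A] y] z by simp
qed

text \<open>A path from below \<open>a\<close> cannot get above \<open>a\<close> without visiting \<open>a\<close>.\<close>

lemma green_kill_below:
  assumes A: "A \<subseteq> E" and a: "a \<in> A" and x: "x \<in> A" "x < a" and z: "z \<in> A" "z < a"
  shows "green {w\<in>A. w < a} x z = green A x z - green A x a * green A a z / green A a a"
proof -
  have "mpow (A - {a}) p n x z = (if z \<in> {w\<in>A. w < a} then mpow {w\<in>A. w < a} p n x z else 0)" for n
    by (rule mpow_no_escape) (use A x z E_subset_S in \<open>auto intro!: skip_free\<close>)
  then have "green {w\<in>A. w < a} x z = green (A - {a}) x z"
    using z by (simp add: green_def)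
  then show ?thesis
    using green_kill_point[of A a z x] A a z E_subset_S by auto
qed

text \<open>Outside \<open>A\<close> the chain is already killed; this includes an absorbing endpoint as starting
  point.\<close>

lemma green_outside:
  assumes "A \<subseteq> S" "x \<notin> A" "x \<noteq> z"
  shows "green A x z = 0"
proof -
  have "mpow A p n x z = 0" for n
    using assms(3)
  proof (induction n arbitrary: z)
    case (Suc n)
    have "mpow A p n x w * p w z = 0" if "w \<in> A" for w z
      using that assms(2) by (induction n arbitrary: w z) (auto intro!: infsum_0)
    then show ?case by (auto intro: infsum_0)
  qed auto
  then show ?thesis by (simp add: green_def)
qed

text \<open>A path from \<open>x\<close> up to \<open>z\<close> has to visit \<open>y\<close>: for \<open>y < z\<close> the killed kernel in
  \<open>green_kill_above\<close> is zero, because it is started at \<open>x \<le> y\<close>.\<close>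

lemma green_through:
  assumes A: "up_closed A" and xy: "x \<in> A" "y \<in> A" "x \<le> y" and z: "z \<in> S" "y \<le> z"
  shows "green A x z * green A y y = green A x y * green A y z"
proof (cases "y = z")
  case False
  then have "green (above E y) x z = 0"
    using xy z by (intro green_outside above_subset_S) (auto simp: above_def)
  then show ?thesis
    using green_kill_above[OF A xy(2) z(1), of x] z False
      green_self_pos[OF up_closed_subset[OF A], of y] xy up_closed_subset[OF A]
    by (auto simp: field_simps)
qed simp

lemma green_up_pos:
  assumes A: "up_closed A" and x: "x \<in> A" and z: "z \<in> S" "x \<le> z"
  shows "0 < green A x z"
  using z(2,1)
proof (induction z rule: int_ge_induct)
  case base
  then show ?case using green_self_pos[OF up_closed_subset[OF A]] by simp
next
  case (step z)
  have AS: "A \<subseteq> S" and AE: "A \<subseteq> E" using A up_closed_subset by (auto simp: up_closed_def)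
  have zE: "z \<in> E" using S_interval[of x "z + 1" z] x AS step by auto
  then have zA: "z \<in> A" using A x step by (auto simp: up_closed_def)
  have pos: "0 < green A x z" using step zE E_subset_S by auto
  have "green A x z * p z (z + 1) \<le> (\<Sum>\<^sub>\<infinity>w\<in>A. green A x w * p w (z + 1))"
    using finite_sum_le_infsum[OF green_flow_summable[OF AS AS step.prems], of "{z}" x] zA
      green_nonneg[OF AS] p_nonneg step.prems AS by (auto simp: subset_iff)
  then have "0 < (\<Sum>\<^sub>\<infinity>w\<in>A. green A x w * p w (z + 1))"
    using pos up_pos[OF zE] mult_pos_pos by (metis order.strict_trans2)
  then have "0 < q * (\<Sum>\<^sub>\<infinity>w\<in>A. green A x w * p w (z + 1))"
    using q_pos by simp
  then show ?case
    using green_forward[OF AS step.prems, of x] by (auto simp: of_bool_def split: if_splits)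
qed

text \<open>Closed form of \<open>H\<^sub>q\<close>: the Martin kernel \<open>K\<^sub>q(x,z)\<close> is the same for all \<open>z \<ge> x, \<oo>\<close>.\<close>

definition Hq :: "int \<Rightarrow> real" where
  "Hq x = green E x (max x \<oo>) / green E \<oo> (max x \<oo>)"

lemma max_in_S: "x \<in> S \<Longrightarrow> max x \<oo> \<in> S"
  using ref_in E_subset_S by (auto simp: max_def)

lemma green_eq_Hq:
  assumes x: "x \<in> S" and z: "z \<in> S" "x \<le> z" "\<oo> \<le> z"
  shows "green E x z = Hq x * green E \<oo> z"
proof (cases "x \<in> E")
  case True
  let ?m = "max x \<oo>"
  have m: "?m \<in> E" using True ref_in by (auto simp: max_def)
  have pos: "0 < green E ?m ?m" "0 < green E \<oo> ?m"
    using green_self_pos[OF E_subset_S] green_up_pos[OF up_closed_E ref_in] m E_subset_S by auto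
  have "green E x z * green E ?m ?m = green E x ?m * green E ?m z"
    using green_through[OF up_closed_E True m _ z(1)] z by auto
  moreover have "green E \<oo> z * green E ?m ?m = green E \<oo> ?m * green E ?m z"
    using green_through[OF up_closed_E ref_in m _ z(1)] z by auto
  ultimately have "green E x z * green E \<oo> ?m * green E ?m ?m = green E x ?m * green E \<oo> z * green E ?m ?m"
    by algebra
  then show ?thesis using pos by (simp add: Hq_def field_simps)
next
  case False
  then have r: "\<rr> = Fin x" using S_cases x by auto
  have "x = z" "\<oo> \<le> x" using S_le[OF z(1)] z E_bounds(2)[OF ref_in] by (simp_all add: r)
  moreover have "0 < green E \<oo> z" using green_up_pos[OF up_closed_E ref_in z(1,3)] .
  ultimately show ?thesis by (simp add: Hq_def max_def)
qed

lemma Hq_pos: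
  assumes "x \<in> S"
  shows "0 < Hq x"
proof (cases "x \<in> E")
  case True
  then show ?thesis
    unfolding Hq_def using assms max_in_S
    by (intro divide_pos_pos green_up_pos[OF up_closed_E]) (auto simp: ref_in)
next
  case False
  then have r: "\<rr> = Fin x" using S_cases assms by auto
  have "\<oo> \<le> x" using E_bounds(2)[OF ref_in] by (simp add: r)
  then have "max x \<oo> = x" by simp
  then show ?thesis
    using green_self_pos[OF E_subset_S assms] green_up_pos[OF up_closed_E ref_in assms \<open>\<oo> \<le> x\<close>]
    by (simp add: Hq_def)
qed

text \<open>Closed form of the normalised limit for the chain killed at or below \<open>y\<close>: the killing identity
  at \<open>y\<close>, divided by \<open>g(\<oo>,z)\<close> for large \<open>z\<close>.\<close>

definition Hq_above :: "int \<Rightarrow> int \<Rightarrow> real" where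
  "Hq_above y x = Hq x - green E x y * Hq y / green E y y"

lemma green_above_eq_Hq_above:
  assumes y: "y \<in> E" and x: "x \<in> S" and z: "z \<in> S" "y < z" "x \<le> z" "\<oo> \<le> z"
  shows "green (above E y) x z = Hq_above y x * green E \<oo> z"
  using green_kill_above[OF up_closed_E y z(1,2), of x] green_eq_Hq[OF x z(1,3,4)]
    green_eq_Hq[of y z] y z E_subset_S
  by (auto simp: Hq_above_def algebra_simps)

text \<open>On the way from \<open>b\<close> to the right end the chain passes \<open>y\<close>, so the functions \<open>g(\<cdot>,y)\<close> and \<open>Hq\<close>
  differ on \<open>{b. b \<le> y}\<close> only by a constant factor.\<close>

lemma green_ratio_Hq:
  assumes b: "b \<in> E" and y: "y \<in> E" "b \<le> y"
  shows "green E b y * Hq y = Hq b * green E y y"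
proof -
  let ?m = "max y \<oo>"
  have m: "?m \<in> S" using max_in_S y E_subset_S by auto
  have "green E b ?m * green E y y = green E b y * green E y ?m"
    using green_through[OF up_closed_E b y(1) y(2) m] by simp
  moreover have "green E b ?m = Hq b * green E \<oo> ?m" "green E y ?m = Hq y * green E \<oo> ?m"
    using b y m E_subset_S by (auto intro!: green_eq_Hq)
  moreover have "0 < green E \<oo> ?m" using green_up_pos[OF up_closed_E ref_in m] by simp
  ultimately show ?thesis by auto
qed

lemma Hq_above_pos:
  assumes "y \<in> E" "x \<in> above E y"
  shows "0 < Hq_above y x"
proof -
  let ?m = "max x \<oo>"
  have x: "x \<in> S" "y < x" using assms E_subset_S by (auto simp: above_def)
  have m: "?m \<in> S" using max_in_S x by auto
  have "green (above E y) x ?m = Hq_above y x * green E \<oo> ?m"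
    using assms x m by (intro green_above_eq_Hq_above) auto
  moreover have "0 < green (above E y) x ?m"
    using green_up_pos[OF up_closed_above assms(2) m] by simp
  moreover have "0 < green E \<oo> ?m" using green_up_pos[OF up_closed_E ref_in m] by simp
  ultimately show ?thesis by (simp add: zero_less_mult_iff)
qed

text \<open>Makes the closed form valid also for \<open>x \<le> y\<close>, where \<open>H_above\<close> is set to \<open>0\<close>.\<close>

lemma Hq_above_0: "y \<in> E \<Longrightarrow> x \<in> E \<Longrightarrow> x \<le> y \<Longrightarrow> Hq_above y x = 0"
  using green_ratio_Hq[of x y] green_self_pos[OF E_subset_S, of y] E_subset_S
  by (auto simp: Hq_above_def field_simps)

text \<open>The first exit formula for a single \<open>y\<close>; the factor \<open>g(y,y) / H(y)\<close> is \<open>C\<^sub>q \<cdot> H_hat(y) \<cdot> \<pi>(y)\<close>.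
  It is the killing identity at \<open>b\<close>, where \<open>g(b,y)\<close> is expressed by \<open>green_ratio_Hq\<close>.\<close>

lemma Hq_above_diff:
  assumes b: "b \<in> E" and y: "y \<in> above E b"
  shows "green E y y / Hq y * (Hq_above b x - Hq_above y x) = green (above E b) x y"
proof -
  have y': "y \<in> E" "b < y" "y \<in> S" using y E_subset_S by (auto simp: above_def)
  have "green (above E b) x y = green E x y - green E x b * green E b y / green E b b"
    using green_kill_above[OF up_closed_E b y'(3,2)] by simp
  moreover have "green E b y = Hq b * green E y y / Hq y"
    using green_ratio_Hq[OF b y'(1)] y' Hq_pos[OF y'(3)] by (auto simp: field_simps)
  moreover have "Hq y \<noteq> 0" "green E y y \<noteq> 0"
    using Hq_pos[OF y'(3)] green_self_pos[OF E_subset_S y'(3)] by auto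
  then have "green E y y / Hq y * (Hq_above b x - Hq_above y x)
      = green E x y - green E x b * (Hq b * green E y y / Hq y) / green E b b"
    by (simp add: Hq_above_def right_diff_distrib)
  ultimately show ?thesis by simp
qed

text \<open>The second exit formula for a single \<open>y\<close>: the chain above \<open>b\<close>, with kernel \<open>g\<^sup>b\<close>, is
  killed once more, at \<open>a\<close>.  Its passage factor \<open>g\<^sup>b(x,a) / g\<^sup>b(a,a)\<close> from \<open>x\<close> up to \<open>a\<close> equals \<open>H\<^sub>b(x) / H\<^sub>b(a)\<close>, since both
  compare the paths from \<open>x\<close> and from \<open>a\<close> to a distant point.\<close>

lemma green_between_eq:
  assumes b: "b \<in> E" and a: "a \<in> above E b" and x: "x \<in> between E b a" and y: "y \<in> between E b a"
  shows "green E y y / Hq y * (Hq_above y a / Hq_above b a * Hq_above b x - Hq_above y x)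
    = green (between E b a) x y"
proof -
  let ?A = "above E b"
  have y': "y \<in> ?A" and x': "x \<in> ?A" and xa: "x < a" and ya: "y < a" and ba: "b < a"
    using x y a by (auto simp: above_def between_def)
  have eq: "{w \<in> ?A. w < a} = between E b a" by (auto simp: above_def between_def)
  have "green (between E b a) x y = green ?A x y - green ?A x a / green ?A a a * green ?A a y"
    using green_kill_below[of ?A a x y] a xa ya x' y' eq by (auto simp: above_def)
  moreover have "green ?A x a / green ?A a a = Hq_above b x / Hq_above b a"
  proof -
    let ?m = "max a \<oo>"
    have aS: "a \<in> S" and xS: "x \<in> S" using a x' above_subset_S by auto
    have m: "?m \<in> S" using max_in_S[OF aS] .
    have "green ?A x ?m * green ?A a a = green ?A x a * green ?A a ?m"
      using green_through[OF up_closed_above x' a _ m] xa by simp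
    moreover have "green ?A x ?m = Hq_above b x * green E \<oo> ?m"
      "green ?A a ?m = Hq_above b a * green E \<oo> ?m"
      using b aS xS m xa ba by (auto intro!: green_above_eq_Hq_above)
    moreover have "0 < green E \<oo> ?m" using green_up_pos[OF up_closed_E ref_in m] by simp
    moreover have "0 < Hq_above b a" "0 < green ?A a a"
      using Hq_above_pos[OF b a] green_self_pos[OF above_subset_S aS] by auto
    ultimately show ?thesis by (simp add: field_simps)
  qed
  ultimately have "green (between E b a) x y
      = green ?A x y - Hq_above b x / Hq_above b a * green ?A a y"
    by (simp only:)
  also have "\<dots> = green E y y / Hq y * ((Hq_above b x - Hq_above y x)
      - Hq_above b x / Hq_above b a * (Hq_above b a - Hq_above y a))"
  proof -
    have "u * v - c * (u * v') = u * (v - c * v')" for u v v' c :: real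
      by (simp add: algebra_simps)
    then show ?thesis
      unfolding Hq_above_diff[OF b y', symmetric] .
  qed
  also have "(Hq_above b x - Hq_above y x)
      - Hq_above b x / Hq_above b a * (Hq_above b a - Hq_above y a)
    = Hq_above y a / Hq_above b a * Hq_above b x - Hq_above y x"
    using Hq_above_pos[OF b a] by (simp add: field_simps)
  finally show ?thesis by simp
qed

end

section \<open>Martin kernels near the two ends\<close>

lemma eventually_to_right:
  assumes "A \<noteq> {}"
  shows "eventually P (to_right A) \<longleftrightarrow> (\<exists>a\<in>A. \<forall>z\<in>A. a \<le> z \<longrightarrow> P z)"
  unfolding to_right_def
proof (subst eventually_INF_base[OF assms])
  fix a b assume "a \<in> A" "b \<in> A"
  then show "\<exists>x\<in>A. principal {z \<in> A. x \<le> z} \<le> principal {z \<in> A. a \<le> z} \<sqinter> principal {z \<in> A. b \<le> z}"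
    by (intro bexI[of _ "max a b"]) (auto simp: max_def)
qed (auto simp: eventually_principal)

lemma eventually_to_left:
  assumes "A \<noteq> {}"
  shows "eventually P (to_left A) \<longleftrightarrow> (\<exists>a\<in>A. \<forall>z\<in>A. z \<le> a \<longrightarrow> P z)"
  unfolding to_left_def
proof (subst eventually_INF_base[OF assms])
  fix a b assume "a \<in> A" "b \<in> A"
  then show "\<exists>x\<in>A. principal {z \<in> A. z \<le> x} \<le> principal {z \<in> A. z \<le> a} \<sqinter> principal {z \<in> A. z \<le> b}"
    by (intro bexI[of _ "min a b"]) (auto simp: min_def)
qed (auto simp: eventually_principal)

lemma to_right_neq_bot: "A \<noteq> {} \<Longrightarrow> to_right A \<noteq> bot"
  by (auto simp: trivial_limit_def eventually_to_right)

lemma to_left_neq_bot: "A \<noteq> {} \<Longrightarrow> to_left A \<noteq> bot"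
  by (auto simp: trivial_limit_def eventually_to_left)

lemma Lim_eventually_const:
  fixes f :: "int \<Rightarrow> real"
  assumes "F \<noteq> bot" "\<forall>\<^sub>F z in F. f z = c"
  shows "Lim F f = c"
  by (rule tendsto_Lim[OF assms(1)]) (rule tendsto_eventually[OF assms(2)])

lemma Lim_to_right_const:
  fixes f :: "int \<Rightarrow> real"
  assumes "a \<in> A" "\<And>z. z \<in> A \<Longrightarrow> a \<le> z \<Longrightarrow> f z = c"
  shows "Lim (to_right A) f = c"
proof (rule Lim_eventually_const)
  have ne: "A \<noteq> {}" using assms by auto
  show "to_right A \<noteq> bot" by (rule to_right_neq_bot[OF ne])
  show "\<forall>\<^sub>F z in to_right A. f z = c" using assms by (auto simp: eventually_to_right[OF ne])
qed

lemma Lim_to_left_const: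
  fixes f :: "int \<Rightarrow> real"
  assumes "a \<in> A" "\<And>z. z \<in> A \<Longrightarrow> z \<le> a \<Longrightarrow> f z = c"
  shows "Lim (to_left A) f = c"
proof (rule Lim_eventually_const)
  have ne: "A \<noteq> {}" using assms by auto
  show "to_left A \<noteq> bot" by (rule to_left_neq_bot[OF ne])
  show "\<forall>\<^sub>F z in to_left A. f z = c" using assms by (auto simp: eventually_to_left[OF ne])
qed

context skip_free_kernel
begin

lemma potential_eq_green:
  assumes "A \<subseteq> S" "z \<in> S"
  shows "potential E A p \<pi> q x z = green A x z / (if z \<in> E then \<pi> z else 1)"
  using suminf_divide[OF green_terms_summable[OF assms], of x]
  by (simp add: potential_def green_def)

lemma martin_kernel_eq_green:
  assumes "A \<subseteq> S" "z \<in> S"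
  shows "martin_kernel E A p \<pi> r q x z = green A x z / green A r z"
  using potential_eq_green[OF assms] \<pi>_pos[of z] by (auto simp: martin_kernel_def)

lemma H_fun_eq_Hq:
  assumes "x \<in> S"
  shows "H_fun E \<rr> p \<pi> \<oo> q x = Hq x"
  unfolding H_fun_def
proof (rule Lim_to_right_const)
  show "max x \<oo> \<in> S" by (rule max_in_S[OF assms])
  fix z assume z: "z \<in> S" "max x \<oo> \<le> z"
  then show "martin_kernel E E p \<pi> \<oo> q x z = Hq x"
    using martin_kernel_eq_green[OF E_subset_S z(1)] green_eq_Hq[OF assms z(1)]
      green_up_pos[OF up_closed_E ref_in z(1)] by auto
qed

text \<open>The dual chain runs the paths backwards.\<close>

lemma mpow_dual:
  assumes "x \<in> E" "y \<in> E"
  shows "mpow E (dual_matrix p \<pi>) n x y = mpow E p n y x * \<pi> y / \<pi> x"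
  using assms(2)
proof (induction n arbitrary: y)
  case 0
  then show ?case using \<pi>_pos[of y] by auto
next
  case (Suc n)
  have "mpow E (dual_matrix p \<pi>) (Suc n) x y
      = (\<Sum>\<^sub>\<infinity>z\<in>E. (p y z * mpow E p n z x) * (\<pi> y / \<pi> x))"
  proof (unfold mpow.simps(2), rule infsum_cong)
    fix z assume "z \<in> E"
    then show "mpow E (dual_matrix p \<pi>) n x z * dual_matrix p \<pi> z y
        = (p y z * mpow E p n z x) * (\<pi> y / \<pi> x)"
      unfolding Suc.IH[OF \<open>z \<in> E\<close>] using \<pi>_pos[of z]
      by (simp add: dual_matrix_def field_simps)
  qed
  also have "\<dots> = mpow E p (Suc n) y x * (\<pi> y / \<pi> x)"
    unfolding infsum_cmult_left' mpow_Suc_left[OF E_subset_S Suc.prems assms(1)] ..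
  finally show ?case by (simp del: mpow.simps)
qed

lemma potential_dual_eq_green:
  assumes "x \<in> E" "y \<in> E"
  shows "potential E E (dual_matrix p \<pi>) \<pi> q x y = green E y x / \<pi> x"
proof -
  have "x \<in> S" using assms E_subset_S by auto
  have "q ^ n * (mpow E (dual_matrix p \<pi>) n x y / \<pi> y) = q ^ n * mpow E p n y x / \<pi> x" for n
    using mpow_dual[OF assms] \<pi>_pos[OF assms(2)] by (simp add: field_simps)
  then show ?thesis
    using assms suminf_divide[OF green_terms_summable[OF E_subset_S \<open>x \<in> S\<close>], of y]
    by (simp add: potential_def green_def)
qed

text \<open>Reversing time turns the dual Martin kernel, up to factors of \<open>\<pi>\<close>, into \<open>g(z,y) / g(z,\<oo>)\<close>.
  For \<open>z\<close> below both \<open>y\<close> and \<open>\<oo>\<close>, the passage from \<open>z\<close> to \<open>min y \<oo>\<close> cancels, so the ratio does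
  not depend on \<open>z\<close>.\<close>

lemma H_hat_eq:
  assumes y: "y \<in> E"
  shows "potential E E p \<pi> q \<oo> \<oo> * H_hat E p \<pi> \<oo> q y * \<pi> y = green E y y / Hq y"
proof -
  let ?m = "min y \<oo>"
  have m: "?m \<in> E" using y ref_in by (auto simp: min_def)
  have mS: "?m \<in> S" "y \<in> S" "\<oo> \<in> S" using m y ref_in E_subset_S by auto
  have pos: "0 < \<pi> \<oo>" "0 < \<pi> y" "0 < green E \<oo> \<oo>" "0 < green E y y" "0 < green E ?m \<oo>"
    "0 < green E ?m ?m"
    using \<pi>_pos y ref_in green_self_pos[OF E_subset_S] mS green_up_pos[OF up_closed_E m mS(3)] by auto
  have "H_hat E p \<pi> \<oo> q y = (green E ?m y / \<pi> y) / (green E ?m \<oo> / \<pi> \<oo>)"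
    unfolding H_hat_def
  proof (rule Lim_to_left_const[OF m])
    fix z assume z: "z \<in> E" "z \<le> ?m"
    have zS: "z \<in> S" using z E_subset_S by auto
    have "green E z y * green E ?m ?m = green E z ?m * green E ?m y"
      "green E z \<oo> * green E ?m ?m = green E z ?m * green E ?m \<oo>"
      using z m mS by (auto intro!: green_through[OF up_closed_E])
    moreover define c where "c = green E z ?m / green E ?m ?m"
    ultimately have "green E z y = c * green E ?m y" "green E z \<oo> = c * green E ?m \<oo>"
      using pos by (simp_all add: c_def eq_divide_eq)
    moreover have "0 < c"
      using pos green_up_pos[OF up_closed_E z(1) mS(1) z(2)] by (simp add: c_def)
    ultimately have ratio: "green E z y / green E z \<oo> = green E ?m y / green E ?m \<oo>"
      by simp
    have "martin_kernel E E (dual_matrix p \<pi>) \<pi> \<oo> q y z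
        = green E z y / green E z \<oo> * (\<pi> \<oo> / \<pi> y)"
      unfolding martin_kernel_def potential_dual_eq_green[OF y z(1)]
        potential_dual_eq_green[OF ref_in z(1)] by simp
    then show "martin_kernel E E (dual_matrix p \<pi>) \<pi> \<oo> q y z
        = (green E ?m y / \<pi> y) / (green E ?m \<oo> / \<pi> \<oo>)"
      unfolding ratio by simp
  qed
  note dual = this
  have pot: "potential E E p \<pi> q \<oo> \<oo> = green E \<oo> \<oo> / \<pi> \<oo>"
    using potential_eq_green[OF E_subset_S mS(3)] ref_in by simp
  have "potential E E p \<pi> q \<oo> \<oo> * H_hat E p \<pi> \<oo> q y * \<pi> y
      = green E \<oo> \<oo> * green E ?m y / green E ?m \<oo>"
    unfolding dual pot using pos by (simp add: field_simps)
  also have "\<dots> = green E y y / Hq y"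
    using pos by (cases "y \<le> \<oo>") (auto simp: Hq_def max_def min_def)
  finally show ?thesis .
qed

lemma ref_shift_in_S:
  assumes "\<rr> = Pinf" "\<oo> \<le> z"
  shows "z \<in> S"
proof (cases "z = \<oo>")
  case False
  then have "Fin \<oo> < Fin z" using assms by simp
  with E_bounds(1)[OF ref_in] have "\<ll> < Fin z" by (rule order.strict_trans1)
  then show ?thesis using E_I[of z] assms E_subset_S by auto
qed (use ref_in E_subset_S in auto)

lemma eventually_to_right_infinite:
  assumes r: "\<rr> = Pinf" and P: "\<forall>\<^sub>F n in sequentially. P (\<oo> + int n)"
  shows "\<forall>\<^sub>F z in to_right S. P z"
proof -
  obtain N where N: "P (\<oo> + int n)" if "N \<le> n" for n
    using P by (auto simp: eventually_sequentially)
  have ne: "S \<noteq> {}" using ref_in E_subset_S by auto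
  have "\<oo> + int N \<in> S" using ref_shift_in_S[OF r] by simp
  moreover have "P z" if "\<oo> + int N \<le> z" for z
    using N[of "nat (z - \<oo>)"] that by simp
  ultimately show ?thesis by (auto simp: eventually_to_right[OF ne])
qed

text \<open>The total mass of the \<open>q\<close>-potential is finite.\<close>

lemma green_ref_tendsto_0:
  assumes r: "\<rr> = Pinf"
  shows "(\<lambda>n. green E \<oo> (\<oo> + int n)) \<longlonglongrightarrow> 0"
proof -
  let ?h = "\<lambda>n. \<oo> + int n"
  have "range ?h \<subseteq> S" using ref_shift_in_S[OF r] by auto
  then have "green E \<oo> summable_on range ?h" by (rule green_summable[OF E_subset_S])
  then have "(green E \<oo> \<circ> ?h) summable_on UNIV"
    by (subst (asm) summable_on_reindex) (auto intro: injI)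
  then show ?thesis
    by (auto dest!: summable_on_imp_summable summable_LIMSEQ_zero simp: o_def)
qed

text \<open>The difference of the quotient from \<open>1\<close> is a constant multiple of \<open>g(x,y) / H(x)\<close>.  At an
  absorbing endpoint \<open>g(x,y) = 0\<close>, and the limit is the value there.  If \<open>\<rr> = \<infinity>\<close>, then \<open>g(x,y)\<close>
  is bounded and \<open>1 / H(x) \<le> g(\<oo>,x)\<close> because \<open>g(x,x) \<ge> 1\<close>; the right-hand side tends to \<open>0\<close>.\<close>

lemma Hq_above_asymp:
  assumes y: "y \<in> E"
  shows "((\<lambda>x. Hq_above y x / Hq x) \<longlongrightarrow> 1) (to_right S)"
proof (cases \<rr>)
  case (Fin k)
  have k: "k \<in> S" "k \<notin> E" using S_I[of k] end_not_in_E[of k] Fin by auto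
  have "\<forall>\<^sub>F x in to_right S. Hq_above y x / Hq x = 1"
  proof (subst eventually_to_right)
    show "\<exists>a\<in>S. \<forall>z\<in>S. a \<le> z \<longrightarrow> Hq_above y z / Hq z = 1"
    proof (intro bexI[OF _ k(1)] ballI impI)
      fix z assume "z \<in> S" "k \<le> z"
      then have "z = k" using S_le[of z] Fin by auto
      moreover have "green E k y = 0" using k y by (intro green_outside[OF E_subset_S]) auto
      ultimately show "Hq_above y z / Hq z = 1"
        using Hq_pos[OF k(1)] by (simp add: Hq_above_def)
    qed
  qed (use k in auto)
  then show ?thesis by (rule tendsto_eventually)
next
  case Pinf
  have yS: "y \<in> S" using y E_subset_S by auto
  define c where "c = 1 / (1 - q) * (Hq y / green E y y)"
  have pos: "0 < Hq y" "0 < green E y y" using Hq_pos yS green_self_pos[OF E_subset_S] by auto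
  have bound: "\<bar>Hq_above y (\<oo> + int n) / Hq (\<oo> + int n) - 1\<bar> \<le> c * green E \<oo> (\<oo> + int n)"
    for n
  proof -
    let ?x = "\<oo> + int n"
    have x: "?x \<in> S" using ref_shift_in_S[OF Pinf] by simp
    have hx: "0 < Hq ?x" by (rule Hq_pos[OF x])
    have "1 \<le> Hq ?x * green E \<oo> ?x"
      using green_eq_Hq[OF x x] green_ge_of_bool[OF E_subset_S x, of ?x] by simp
    then have inv: "1 / Hq ?x \<le> green E \<oo> ?x" using hx by (simp add: field_simps)
    have "Hq_above y ?x / Hq ?x - 1 = - (green E ?x y * (Hq y / green E y y) * (1 / Hq ?x))"
      using hx by (simp add: Hq_above_def diff_divide_distrib)
    then have "\<bar>Hq_above y ?x / Hq ?x - 1\<bar> = green E ?x y * (Hq y / green E y y) * (1 / Hq ?x)"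
      using hx pos green_nonneg[OF E_subset_S yS, of ?x] by (simp add: abs_mult)
    also have "\<dots> \<le> c * green E \<oo> ?x"
      unfolding c_def using hx pos inv green_le[OF E_subset_S yS, of ?x]
        green_nonneg[OF E_subset_S yS, of ?x] q_less_1
      by (intro mult_mono mult_nonneg_nonneg) auto
    finally show ?thesis .
  qed
  have "(\<lambda>n. c * green E \<oo> (\<oo> + int n)) \<longlonglongrightarrow> 0"
    using tendsto_mult_right_zero[OF green_ref_tendsto_0[OF Pinf]] .
  then have "(\<lambda>n. Hq_above y (\<oo> + int n) / Hq (\<oo> + int n) - 1) \<longlonglongrightarrow> 0"
    by (rule Lim_null_comparison[rotated]) (use bound in auto)
  then have "(\<lambda>n. Hq_above y (\<oo> + int n) / Hq (\<oo> + int n)) \<longlonglongrightarrow> 1"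
    by (simp add: LIM_zero_iff)
  then show ?thesis
    unfolding tendsto_def by (auto intro!: eventually_to_right_infinite[OF Pinf])
next
  case Minf
  then show ?thesis using E_bounds(2)[OF ref_in] by simp
qed

context
  fixes ref :: "int \<Rightarrow> int"
  assumes ref: "\<And>y. y \<in> E \<Longrightarrow> above E y \<noteq> {} \<Longrightarrow> ref y \<in> above E y"
begin

lemma K_limit_above_eq:
  assumes y: "y \<in> E" "above E y \<noteq> {}" and x: "x \<in> S"
  shows "K_limit_above E \<rr> p \<pi> ref q y x = Hq_above y x / Hq_above y (ref y)"
  unfolding K_limit_above_def
proof (rule Lim_to_right_const)
  have r: "ref y \<in> E" "y < ref y" "ref y \<in> S" using ref[OF y] E_subset_S by (auto simp: above_def)
  show "max x (max \<oo> (ref y)) \<in> S" using r x ref_in E_subset_S by (auto simp: max_def)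
  fix z assume z: "z \<in> S" "max x (max \<oo> (ref y)) \<le> z"
  have "green (above E y) x z = Hq_above y x * green E \<oo> z"
    "green (above E y) (ref y) z = Hq_above y (ref y) * green E \<oo> z"
    using y x r z by (auto intro!: green_above_eq_Hq_above)
  then show "martin_kernel E (above E y) p \<pi> (ref y) q x z = Hq_above y x / Hq_above y (ref y)"
    using martin_kernel_eq_green[OF above_subset_S z(1)] green_up_pos[OF up_closed_E ref_in z(1)] z
    by auto
qed

text \<open>The limit in the definition is proportional to the constant, hence equal to \<open>1\<close> for exactly
  one of them.\<close>

lemma kappa_eq:
  assumes y: "y \<in> E" "above E y \<noteq> {}"
  shows "kappa E \<rr> p \<pi> \<oo> ref q y = Hq_above y (ref y)"
proof -
  let ?h = "Hq_above y (ref y)"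
  have h: "0 < ?h" using Hq_above_pos ref y by auto
  have ne: "S \<noteq> {}" using ref_in E_subset_S by auto
  have lim: "((\<lambda>x. k * K_limit_above E \<rr> p \<pi> ref q y x / H_fun E \<rr> p \<pi> \<oo> q x) \<longlongrightarrow> k / ?h) (to_right S)" for k
  proof -
    have "((\<lambda>x. k / ?h * (Hq_above y x / Hq x)) \<longlongrightarrow> k / ?h * 1) (to_right S)"
      by (intro tendsto_mult_left Hq_above_asymp y)
    moreover have "\<forall>\<^sub>F x in to_right S. k / ?h * (Hq_above y x / Hq x)
        = k * K_limit_above E \<rr> p \<pi> ref q y x / H_fun E \<rr> p \<pi> \<oo> q x"
      using ne K_limit_above_eq[OF y] H_fun_eq_Hq by (auto simp: eventually_to_right[OF ne])
    ultimately show ?thesis by (simp add: tendsto_cong)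
  qed
  show ?thesis
    unfolding kappa_def
  proof (rule the_equality)
    show "0 < ?h \<and> ((\<lambda>x. ?h * K_limit_above E \<rr> p \<pi> ref q y x / H_fun E \<rr> p \<pi> \<oo> q x) \<longlongrightarrow> 1) (to_right S)"
      using lim[of ?h] h by simp
    show "k = ?h" if "0 < k \<and> ((\<lambda>x. k * K_limit_above E \<rr> p \<pi> ref q y x / H_fun E \<rr> p \<pi> \<oo> q x) \<longlongrightarrow> 1) (to_right S)" for k
      using tendsto_unique[OF to_right_neq_bot[OF ne] lim[of k] conjunct2[OF that]] h by simp
  qed
qed

lemma H_above_eq:
  assumes y: "y \<in> E" and x: "x \<in> E"
  shows "H_above E \<rr> p \<pi> \<oo> ref q y x = Hq_above y x"
proof (cases "y < x")
  case True
  then have ne: "above E y \<noteq> {}" using x by (auto simp: above_def)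
  have "0 < Hq_above y (ref y)" using Hq_above_pos ref y ne by auto
  then show ?thesis
    using True kappa_eq[OF y ne] K_limit_above_eq[OF y ne, of x] x E_subset_S
    by (auto simp: H_above_def)
qed (use Hq_above_0[OF y x] in \<open>simp add: H_above_def\<close>)

lemma above_sum:
  assumes b: "b \<in> E" and x: "x \<in> above E b"
  shows "potential E E p \<pi> q \<oo> \<oo> * (\<Sum>\<^sub>\<infinity>y\<in>above E b. H_hat E p \<pi> \<oo> q y *
      (H_above E \<rr> p \<pi> \<oo> ref q b x - H_above E \<rr> p \<pi> \<oo> ref q y x) * \<pi> y)
    = (\<Sum>\<^sub>\<infinity>y\<in>above E b. green (above E b) x y)"
  unfolding infsum_cmult_right'[symmetric]
proof (rule infsum_cong)
  fix y assume y: "y \<in> above E b"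
  then have yE: "y \<in> E" and xE: "x \<in> E" using x by (auto simp: above_def)
  have "potential E E p \<pi> q \<oo> \<oo> * H_hat E p \<pi> \<oo> q y * \<pi> y * (Hq_above b x - Hq_above y x)
      = green (above E b) x y"
    unfolding H_hat_eq[OF yE] by (rule Hq_above_diff[OF b y])
  then show "potential E E p \<pi> q \<oo> \<oo> * (H_hat E p \<pi> \<oo> q y *
      (H_above E \<rr> p \<pi> \<oo> ref q b x - H_above E \<rr> p \<pi> \<oo> ref q y x) * \<pi> y) = green (above E b) x y"
    unfolding H_above_eq[OF b xE] H_above_eq[OF yE xE] by (simp only: ac_simps)
qed

lemma between_sum:
  assumes b: "b \<in> E" and a: "a \<in> above E b" and x: "x \<in> between E b a"
  shows "potential E E p \<pi> q \<oo> \<oo> * (\<Sum>\<^sub>\<infinity>y\<in>between E b a. H_hat E p \<pi> \<oo> q y *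
      (H_above E \<rr> p \<pi> \<oo> ref q y a / H_above E \<rr> p \<pi> \<oo> ref q b a * H_above E \<rr> p \<pi> \<oo> ref q b x
        - H_above E \<rr> p \<pi> \<oo> ref q y x) * \<pi> y)
    = (\<Sum>\<^sub>\<infinity>y\<in>between E b a. green (between E b a) x y)"
  unfolding infsum_cmult_right'[symmetric]
proof (rule infsum_cong)
  fix y assume y: "y \<in> between E b a"
  then have yE: "y \<in> E" and xE: "x \<in> E" and aE: "a \<in> E"
    using x a by (auto simp: above_def between_def)
  have "potential E E p \<pi> q \<oo> \<oo> * H_hat E p \<pi> \<oo> q y * \<pi> y
      * (Hq_above y a / Hq_above b a * Hq_above b x - Hq_above y x)
      = green (between E b a) x y"
    unfolding H_hat_eq[OF yE] by (rule green_between_eq[OF b a x y])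
  then show "potential E E p \<pi> q \<oo> \<oo> * (H_hat E p \<pi> \<oo> q y *
      (H_above E \<rr> p \<pi> \<oo> ref q y a / H_above E \<rr> p \<pi> \<oo> ref q b a * H_above E \<rr> p \<pi> \<oo> ref q b x
        - H_above E \<rr> p \<pi> \<oo> ref q y x) * \<pi> y) = green (between E b a) x y"
    unfolding H_above_eq[OF b xE] H_above_eq[OF yE xE] H_above_eq[OF b aE] H_above_eq[OF yE aE]
    by (simp only: ac_simps)
qed

end

lemma exit_above_complement:
  assumes "b \<in> E"
  shows "S - ({z\<in>E. z \<le> b} \<union> absorbing_end E \<rr>) = above E b"
  by (auto simp: states_def above_def absorbing_end_def)

text \<open>An absorbing right endpoint belongs to the complement of \<open>{z\<in>E. z \<le> b \<or> a \<le> z}\<close>, but from below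
  \<open>a\<close> it can only be reached through \<open>a\<close>.\<close>

lemma exit_between_sum:
  assumes a: "a \<in> E" "b < a" and x: "x \<in> between E b a"
  shows "(\<Sum>\<^sub>\<infinity>y\<in>S - {z\<in>E. z \<le> b \<or> a \<le> z}. green (S - {z\<in>E. z \<le> b \<or> a \<le> z}) x y)
    = (\<Sum>\<^sub>\<infinity>y\<in>between E b a. green (between E b a) x y)"
proof -
  let ?B' = "S - {z\<in>E. z \<le> b \<or> a \<le> z}" and ?B = "between E b a"
  have sub: "?B \<subseteq> ?B'" using E_subset_S by (auto simp: between_def)
  have "p w z = 0" if "w \<in> ?B" "z \<in> ?B' - ?B" for w z
  proof -
    have z: "z \<in> S" "z \<notin> E" using that by (auto simp: between_def)
    then have "\<rr> = Fin z" using S_cases by auto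
    then have "a < z" using E_bounds(2)[OF a(1)] by simp
    then show ?thesis using that z by (intro skip_free) (auto simp: between_def)
  qed
  then have powers: "mpow ?B' p n x z = (if z \<in> ?B then mpow ?B p n x z else 0)" if "z \<in> ?B'" for n z
    using that by (intro mpow_no_escape[OF sub x])
  show ?thesis
    by (rule infsum_cong_neutral) (use sub powers in \<open>auto simp: green_def\<close>)
qed

end

section \<open>The exit formulas\<close>

theorem theorem4p1:
  fixes E :: "int set" and \<ll> \<rr> :: "int extended"
    and p :: "int \<Rightarrow> int \<Rightarrow> real" and \<pi> :: "int \<Rightarrow> real"
    and Pr :: "int \<Rightarrow> 'w measure" and X :: "nat \<Rightarrow> 'w \<Rightarrow> int"
    and \<oo> :: int and ref :: "int \<Rightarrow> int" and q :: real
  assumes "skip_free_class_inf E \<ll> \<rr> p"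
    and "markov_chain (states E \<rr>) p Pr X"
    and "excessive_measure E p \<pi>"
    and "\<oo> \<in> E" and "Fin (\<oo> + 1) < \<rr>"
    and "\<And>y. y \<in> E \<Longrightarrow> above E y \<noteq> {} \<Longrightarrow> ref y \<in> above E y"
    and "0 < q" and "q \<le> 1"
    and "q = 1 \<Longrightarrow> transient_chain E Pr X"
  shows
    "(\<forall>b\<in>E. \<forall>x\<in>above E b.
        (\<integral>\<omega>. epow q (hitting_time X ({z\<in>E. z \<le> b} \<union> absorbing_end E \<rr>) \<omega>) \<partial>Pr x) =
        1 + (q - 1) * potential E E p \<pi> q \<oo> \<oo> *
          (\<Sum>\<^sub>\<infinity>y\<in>above E b. H_hat E p \<pi> \<oo> q y *
             (H_above E \<rr> p \<pi> \<oo> ref q b x - H_above E \<rr> p \<pi> \<oo> ref q y x) * \<pi> y)) \<and>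
     (\<forall>b\<in>E. \<forall>a\<in>E. b < a \<longrightarrow> (\<forall>x\<in>between E b a.
        (\<integral>\<omega>. epow q (hitting_time X {z\<in>E. z \<le> b \<or> a \<le> z} \<omega>) \<partial>Pr x) =
        1 + (q - 1) * potential E E p \<pi> q \<oo> \<oo> *
          (\<Sum>\<^sub>\<infinity>y\<in>between E b a. H_hat E p \<pi> \<oo> q y *
             (H_above E \<rr> p \<pi> \<oo> ref q y a / H_above E \<rr> p \<pi> \<oo> ref q b a
                * H_above E \<rr> p \<pi> \<oo> ref q b x
              - H_above E \<rr> p \<pi> \<oo> ref q y x) * \<pi> y)))"
proof (cases "q = 1")
  case True
  have one: "(^) q = (\<lambda>n. 1)"
    using True by (simp add: fun_eq_iff)
  then have "lim ((^) q) = 1"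
    by (metis limI tendsto_const)
  then have "epow q t = 1" for t
    by (cases t) (simp_all add: epow_def fun_cong[OF one])
  moreover have "measure (Pr x) (space (Pr x)) = 1" if "x \<in> E" for x
    using assms(2) that by (auto simp: markov_chain_def states_def intro!: prob_space.prob_space)
  ultimately show ?thesis
    using True by (auto simp: above_def between_def)
next
  case False
  interpret skip_free_kernel E \<rr> p q \<ll> \<pi> \<oo>
    using assms False
    by unfold_locales (auto simp: skip_free_class_inf_def skip_free_class_def excessive_measure_def)
  note sum_above = above_sum[OF assms(6)] and sum_between = between_sum[OF assms(6)]
  have *: "1 - (1 - q) * s = 1 + (q - 1) * c * t" if "c * t = s" for s c t :: real
    using that by (simp add: algebra_simps flip: that)
  show ?thesis
  proof (intro conjI ballI impI)
    fix b x assume b: "b \<in> E" and x: "x \<in> above E b"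
    let ?C = "{z\<in>E. z \<le> b} \<union> absorbing_end E \<rr>"
    have xC: "x \<in> S" "x \<notin> ?C" using x exit_above_complement[OF b] by auto
    show "(\<integral>\<omega>. epow q (hitting_time X ?C \<omega>) \<partial>Pr x) =
        1 + (q - 1) * potential E E p \<pi> q \<oo> \<oo> *
          (\<Sum>\<^sub>\<infinity>y\<in>above E b. H_hat E p \<pi> \<oo> q y *
             (H_above E \<rr> p \<pi> \<oo> ref q b x - H_above E \<rr> p \<pi> \<oo> ref q y x) * \<pi> y)"
      unfolding expectation_epow_hitting_time[OF assms(2) xC] exit_above_complement[OF b]
      by (rule *) (rule sum_above[OF _ _ b x])
  next
    fix b a x assume b: "b \<in> E" and a: "a \<in> E" "b < a" and x: "x \<in> between E b a"
    let ?C = "{z\<in>E. z \<le> b \<or> a \<le> z}"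
    have xC: "x \<in> S" "x \<notin> ?C" using x E_subset_S by (auto simp: between_def)
    have a': "a \<in> above E b" using a by (simp add: above_def)
    show "(\<integral>\<omega>. epow q (hitting_time X ?C \<omega>) \<partial>Pr x) =
        1 + (q - 1) * potential E E p \<pi> q \<oo> \<oo> *
          (\<Sum>\<^sub>\<infinity>y\<in>between E b a. H_hat E p \<pi> \<oo> q y *
             (H_above E \<rr> p \<pi> \<oo> ref q y a / H_above E \<rr> p \<pi> \<oo> ref q b a
                * H_above E \<rr> p \<pi> \<oo> ref q b x
              - H_above E \<rr> p \<pi> \<oo> ref q y x) * \<pi> y)"
      unfolding expectation_epow_hitting_time[OF assms(2) xC] exit_between_sum[OF a x]
      by (rule *) (rule sum_between[OF _ _ b a' x])
  qed
qed

end
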